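(* For all integers $m\ge 0$ and $n\ge 0$, \[N_S(m,n)\ \ge\ N_S(m+1,n).\]
   Context: Let $\mathcal{D}$ be the set of partitions into distinct parts and $\mathcal{P}$ the set of all (integer) partitions. For a partition $\pi$, $\ell(\pi)$ is its number of parts, $|\pi|$ its sum, and $s(\pi)$ its smallest part, with the convention $s(\emptyset)=+\infty$. Let \[S=\{(\pi_1,\pi_2,\pi_3)\in\mathcal{D}\times\mathcal{P}\times\mathcal{P}:\ \pi_1\neq\emptyset,\ s(\pi_1)\le\min\{s(\pi_2),s(\pi_3)\}\}.\] For $\pi=(\pi_1,\pi_2,\pi_3)\in S$ put $|\pi|=|\pi_1|+|\pi_2|+|\pi_3|$, define the spt-crank $r(\pi)=\ell(\pi_2)-\ell(\pi_3)$ and the sign $\omega(\pi)=(-1)^{\ell(\pi_1)-1}$. Then $N_S(m,n)=\sum_{\pi\in S,\ |\pi|=n,\ r(\pi)=m}\omega(\pi)$. *)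

theory Defs
  imports Main "HOL-Library.Multiset"
begin

definition is_partition :: "nat multiset \<Rightarrow> bool" where
  "is_partition p \<longleftrightarrow> (\<forall>x\<in>#p. 0 < x)"

definition is_distinct_partition :: "nat set \<Rightarrow> bool" where
  "is_distinct_partition d \<longleftrightarrow> finite d \<and> 0 \<notin> d"

text \<open>The set S of triples (pi1, pi2, pi3): pi1 nonempty with distinct parts, pi2, pi3
  arbitrary partitions, and the smallest part of pi1 at most every part of pi2 and pi3
  (this encodes s(pi1) \<le> min(s(pi2), s(pi3)) with s(empty) = infinity).\<close>

definition spt_S :: "(nat set \<times> nat multiset \<times> nat multiset) set" where
  "spt_S = {(p1, p2, p3). is_distinct_partition p1 \<and> p1 \<noteq> {} \<and>
      is_partition p2 \<and> is_partition p3 \<and>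
      (\<forall>x\<in>#p2. Min p1 \<le> x) \<and> (\<forall>x\<in>#p3. Min p1 \<le> x)}"

definition spt_weight :: "nat set \<times> nat multiset \<times> nat multiset \<Rightarrow> nat" where
  "spt_weight t = (case t of (p1, p2, p3) \<Rightarrow> \<Sum>p1 + sum_mset p2 + sum_mset p3)"

definition spt_crank :: "nat set \<times> nat multiset \<times> nat multiset \<Rightarrow> int" where
  "spt_crank t = (case t of (p1, p2, p3) \<Rightarrow> int (size p2) - int (size p3))"

definition spt_sign :: "nat set \<times> nat multiset \<times> nat multiset \<Rightarrow> int" where
  "spt_sign t = (case t of (p1, p2, p3) \<Rightarrow> (-1) ^ (card p1 - 1))"

definition N_S :: "int \<Rightarrow> nat \<Rightarrow> int" where
  "N_S m n = (\<Sum>t \<in> {t \<in> spt_S. spt_weight t = n \<and> spt_crank t = m}. spt_sign t)"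

end

theory Submission
  imports Defs "HOL-Computational_Algebra.Formal_Power_Series"
begin

text \<open>
  Write \<open>(q)_n\<close> for the product of the \<open>1 - q^i\<close> with \<open>1 \<le> i \<le> n\<close>. Summing over the smallest part of
  \<open>\<pi>1\<close> first shows that \<open>N_S(m, -)\<close> has the generating function
  \<open>\<Sum>l. ((q)_(2l+m) - (q)_\<infinity>) / ((q)_l (q)_(l+m))\<close>. Hence the difference
  \<open>D_m = N_S(m, -) - N_S(m + 1, -)\<close> has the generating function
  \<open>\<Sum>l. q^(l+m+1) ((q)_\<infinity> - (1 - q^l) (q)_(2l+m)) / ((q)_l (q)_(l+m+1))\<close>.

  Let \<open>Z(a, b; c)\<close> generate the pairs \<open>(X, Y)\<close> with \<open>X \<subseteq> {2..a}\<close>, \<open>Y \<subseteq> {1..b}\<close> and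
  \<open>|Y| - |X| = c\<close> by the sum of all their elements, and put \<open>K = m (m + 1) / 2\<close>. Telescoping turns
  \<open>q^K D_m\<close> into \<open>q^(K+m+1)\<close> plus the sum over \<open>k \<ge> 1\<close> of
  \<open>q^(2k+m+1) (q^m Z(k, k+m-1; m-1) - Z(k-1, k+m-1; m+2))\<close>.

  Matching possible elements of \<open>X\<close> and \<open>Y\<close> that are symmetric about a centre (an element \<open>x\<close> of \<open>X\<close>
  sitting at position \<open>-x\<close>) gives sequences in \<open>c\<close> that are, up to powers of \<open>q\<close>, symmetric and
  decreasing away from the middle in steps of two. For \<open>m \<ge> 1\<close> the centres \<open>m\<close> and \<open>0\<close> make every
  bracket nonnegative. For \<open>m = 0\<close> the matching of \<open>x\<close> with \<open>y = x + 2\<close> leaves a negative part in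
  the brackets with \<open>k \<ge> 4\<close>, which positive parts of other brackets absorb.
\<close>

subsection \<open>Coefficientwise order\<close>

abbreviation q :: "real fps" where "q \<equiv> fps_X"

definition coeff_le :: "real fps \<Rightarrow> real fps \<Rightarrow> bool" (infix "\<preceq>" 50) where
  "f \<preceq> g \<longleftrightarrow> (\<forall>n. fps_nth f n \<le> fps_nth g n)"

lemma coeff_le_refl [simp]: "f \<preceq> f"
  by (simp add: coeff_le_def)

lemma coeff_leD: "f \<preceq> g \<Longrightarrow> fps_nth f i \<le> fps_nth g i"
  by (simp add: coeff_le_def)

lemma coeff_le_trans [trans]: "f \<preceq> g \<Longrightarrow> g \<preceq> h \<Longrightarrow> f \<preceq> h"
  unfolding coeff_le_def using order_trans by blast

lemma coeff_le_add: "f \<preceq> g \<Longrightarrow> f' \<preceq> g' \<Longrightarrow> f + f' \<preceq> g + g'"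
  by (simp add: coeff_le_def add_mono)

lemma coeff_le_diff_iff: "0 \<preceq> g - f \<longleftrightarrow> f \<preceq> g"
  by (simp add: coeff_le_def)

lemma coeff_le_mult_q: "f \<preceq> g \<Longrightarrow> q ^ k * f \<preceq> q ^ k * g"
  by (simp add: coeff_le_def fps_X_power_mult_nth)

lemma coeff_le_sum: "(\<And>i. i \<in> I \<Longrightarrow> f i \<preceq> g i) \<Longrightarrow> sum f I \<preceq> sum g I"
  by (simp add: coeff_le_def fps_sum_nth sum_mono)

lemma nonneg_add: "0 \<preceq> f \<Longrightarrow> 0 \<preceq> g \<Longrightarrow> 0 \<preceq> f + g"
  by (simp add: coeff_le_def)

lemma nonneg_mult_q: "0 \<preceq> f \<Longrightarrow> 0 \<preceq> q ^ k * f"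
  by (simp add: coeff_le_def fps_X_power_mult_nth)

lemma nonneg_sum: "(\<And>i. i \<in> I \<Longrightarrow> 0 \<preceq> f i) \<Longrightarrow> 0 \<preceq> sum f I"
  by (simp add: coeff_le_def fps_sum_nth sum_nonneg)

lemma nonneg_power_q [simp]: "0 \<preceq> q ^ k"
  by (simp add: coeff_le_def)

subsection \<open>Congruence modulo high powers of q\<close>

text \<open>A bound \<open>L\<close> replaces infinity throughout: identities of infinite sums and
  products become congruences modulo \<open>q ^ (n + 1)\<close> between finite ones.\<close>

definition eq_upto :: "nat \<Rightarrow> real fps \<Rightarrow> real fps \<Rightarrow> bool" where
  "eq_upto n f g \<longleftrightarrow> (\<forall>i\<le>n. fps_nth f i = fps_nth g i)"

lemma eq_upto_refl [simp]: "eq_upto n f f"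
  by (simp add: eq_upto_def)

lemma eq_upto_sym: "eq_upto n f g \<Longrightarrow> eq_upto n g f"
  by (simp add: eq_upto_def)

lemma eq_upto_trans [trans]: "eq_upto n f g \<Longrightarrow> eq_upto n g h \<Longrightarrow> eq_upto n f h"
  by (simp add: eq_upto_def)

lemma eq_upto_mono: "eq_upto n f g \<Longrightarrow> k \<le> n \<Longrightarrow> eq_upto k f g"
  by (simp add: eq_upto_def)

lemma eq_upto_add: "eq_upto n f g \<Longrightarrow> eq_upto n f' g' \<Longrightarrow> eq_upto n (f + f') (g + g')"
  by (simp add: eq_upto_def)

lemma eq_upto_diff: "eq_upto n f g \<Longrightarrow> eq_upto n f' g' \<Longrightarrow> eq_upto n (f - f') (g - g')"
  by (simp add: eq_upto_def)

lemma eq_upto_mult: "eq_upto n f g \<Longrightarrow> eq_upto n f' g' \<Longrightarrow> eq_upto n (f * f') (g * g')"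
  by (simp add: eq_upto_def fps_mult_nth)

lemma eq_upto_sum: "(\<And>i. i \<in> I \<Longrightarrow> eq_upto n (f i) (g i)) \<Longrightarrow> eq_upto n (sum f I) (sum g I)"
  by (simp add: eq_upto_def fps_sum_nth)

lemma eq_upto_power_mult: "n < k \<Longrightarrow> eq_upto n (q ^ k * f) 0"
  by (simp add: eq_upto_def fps_X_power_mult_nth)

lemma eq_upto_power: "n < k \<Longrightarrow> eq_upto n (q ^ k) 0"
  using eq_upto_power_mult[of n k 1] by simp

lemma eq_upto_shift: "eq_upto n f g \<Longrightarrow> eq_upto (n + k) (q ^ k * f) (q ^ k * g)"
  by (simp add: eq_upto_def fps_X_power_mult_nth)

subsection \<open>Pairs of finite sets with prescribed size difference\<close>

text \<open>For finite sets this is the coefficient of zeta^c in the product of all 1 + q^x / zeta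
  with x in \<open>A\<close> and all 1 + zeta q^y with y in \<open>B\<close>.\<close>

definition pair_gf :: "nat set \<Rightarrow> nat set \<Rightarrow> int \<Rightarrow> real fps" where
  "pair_gf A B c = (\<Sum>S\<in>Pow A. \<Sum>T\<in>Pow B.
     if int (card T) - int (card S) = c then q ^ (\<Sum>S + \<Sum>T) else 0)"

lemma sum_Pow_insert:
  assumes "finite A" "a \<notin> A"
  shows "sum g (Pow (insert a A)) = sum g (Pow A) + (\<Sum>S\<in>Pow A. g (insert a S))"
proof -
  have "sum g (Pow (insert a A)) = sum g (Pow A) + sum g (insert a ` Pow A)"
    unfolding Pow_insert using assms by (intro sum.union_disjoint) auto
  also have "sum g (insert a ` Pow A) = (\<Sum>S\<in>Pow A. g (insert a S))"
    using assms by (subst sum.reindex) (auto simp: inj_on_def)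
  finally show ?thesis .
qed

lemma pair_gf_swap: "pair_gf A B c = pair_gf B A (- c)"
  unfolding pair_gf_def
  by (subst sum.swap) (auto intro!: sum.cong simp: add.commute)

lemma pair_gf_insert_right:
  assumes "finite A" "finite B" "b \<notin> B"
  shows "pair_gf A (insert b B) c = pair_gf A B c + q ^ b * pair_gf A B (c - 1)"
proof -
  have *: "(\<Sum>T\<in>Pow (insert b B). if int (card T) - int (card S) = c then q ^ (\<Sum>S + \<Sum>T) else 0)
    = (\<Sum>T\<in>Pow B. if int (card T) - int (card S) = c then q ^ (\<Sum>S + \<Sum>T) else 0)
    + q ^ b * (\<Sum>T\<in>Pow B. if int (card T) - int (card S) = c - 1 then q ^ (\<Sum>S + \<Sum>T) else 0)"
    if "S \<in> Pow A" for S
  proof -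
    have eq: "(if int (card (insert b T)) - int (card S) = c then q ^ (\<Sum>S + \<Sum>(insert b T)) else 0)
      = q ^ b * (if int (card T) - int (card S) = c - 1 then q ^ (\<Sum>S + \<Sum>T) else 0)"
      if "T \<in> Pow B" for T
    proof -
      have "finite T" "b \<notin> T"
        using that assms finite_subset by auto
      then show ?thesis
        by (auto simp: power_add)
    qed
    show ?thesis
      unfolding sum_Pow_insert[OF assms(2,3)] sum_distrib_left
      by (intro arg_cong2[where f="(+)"] refl sum.cong eq)
  qed
  show ?thesis
    unfolding pair_gf_def sum_distrib_left sum.distrib[symmetric]
    using * by (intro sum.cong[OF refl]) (simp add: sum_distrib_left sum.distrib)
qed

lemma pair_gf_insert_left:
  assumes "finite A" "finite B" "a \<notin> A"
  shows "pair_gf (insert a A) B c = pair_gf A B c + q ^ a * pair_gf A B (c + 1)"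
proof -
  have "- c - 1 = - (c + 1)" by simp
  then show ?thesis
    using pair_gf_insert_right[OF assms(2,1,3), of "- c"]
    by (simp only: pair_gf_swap[of "insert a A"] pair_gf_swap[of A])
qed

lemma pair_gf_empty: "pair_gf {} {} c = (if c = 0 then 1 else 0)"
  by (simp add: pair_gf_def)

lemma pair_gf_nonneg: "0 \<preceq> pair_gf A B c"
  unfolding pair_gf_def by (intro nonneg_sum) auto

lemma pair_gf_zero:
  assumes "finite B" "int (card B) < c"
  shows "pair_gf A B c = 0"
  unfolding pair_gf_def
proof (intro sum.neutral ballI)
  fix S T assume "S \<in> Pow A" "T \<in> Pow B"
  then have "card T \<le> card B"
    using assms card_mono by auto
  then show "(if int (card T) - int (card S) = c then q ^ (\<Sum>S + \<Sum>T) else 0) = 0"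
    using assms by auto
qed

lemma pair_gf_shift_right:
  assumes "finite B"
  shows "pair_gf {} (Suc ` B) (int c) = q ^ c * pair_gf {} B (int c)"
  using assms
proof (induction B arbitrary: c rule: finite_induct)
  case empty
  then show ?case by (simp add: pair_gf_empty)
next
  case (insert b B)
  have "Suc b \<notin> Suc ` B" using insert by auto
  note [simp] = this
  show ?case
  proof (cases c)
    case 0
    have "pair_gf {} B (- 1) = 0" for B
      by (auto simp: pair_gf_def)
    then show ?thesis
      using insert 0 insert.IH[of 0] by (simp add: pair_gf_insert_right)
  next
    case (Suc k)
    have "int c - 1 = int k" using Suc by simp
    then show ?thesis
      using insert.hyps insert.IH[of c] insert.IH[of k] Suc
      by (simp add: pair_gf_insert_right algebra_simps)
  qed
qed

text \<open>Raising each element of \<open>T\<close> by one adds |T| = c + |S| to the total. The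
  summand |S| amounts to raising each element of \<open>S\<close> instead, and \<open>q ^ c\<close>
  remains.\<close>

lemma pair_gf_shift:
  assumes "finite A" "finite B"
  shows "pair_gf A (Suc ` B) (int c) = q ^ c * pair_gf (Suc ` A) B (int c)"
  using assms
proof (induction A arbitrary: c rule: finite_induct)
  case empty
  then show ?case by (simp add: pair_gf_shift_right)
next
  case (insert a A)
  have "Suc a \<notin> Suc ` A" using insert by auto
  moreover have "int c + 1 = int (Suc c)" by simp
  ultimately show ?case
    using insert.hyps insert.prems insert.IH[of c] insert.IH[of "Suc c"]
    by (simp add: pair_gf_insert_left algebra_simps)
qed

subsection \<open>Balanced sequences\<close>

text \<open>
  The coefficients in \<open>\<zeta>\<close> of products of factors \<open>(1 + \<zeta> q^(x+s)) (1 + q^x / \<zeta>)\<close> and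
  \<open>(1 + \<zeta> q^y) (1 + \<zeta> q^(s-y))\<close> are balanced, because \<open>\<zeta> q^(s/2)\<close> makes each factor palindromic
  and unimodal. Each factor of the second kind moves the centre \<open>N\<close> up by one.
\<close>

definition balanced :: "nat \<Rightarrow> int \<Rightarrow> (int \<Rightarrow> real fps) \<Rightarrow> bool" where
  "balanced s N f \<longleftrightarrow>
     (\<forall>d. f (N + int d) = q ^ (s * d) * f (N - int d)) \<and>
     (\<forall>d. q ^ s * f (N - int d - 2) \<preceq> f (N - int d))"

text \<open>The right half of balancedness alone; unlike the symmetry, it survives the insertion of
  elements that have no mirror image.\<close>

definition decreasing :: "nat \<Rightarrow> int \<Rightarrow> (int \<Rightarrow> real fps) \<Rightarrow> bool" where
  "decreasing s c0 f \<longleftrightarrow> (\<forall>c\<ge>c0. f (c + 2) \<preceq> q ^ s * f c)"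

lemma decreasingD: "decreasing s c0 f \<Longrightarrow> c0 \<le> c \<Longrightarrow> f (c + 2) \<preceq> q ^ s * f c"
  by (simp add: decreasing_def)

lemma balanced_sym:
  "balanced s N f \<Longrightarrow> f (N + int d) = q ^ (s * d) * f (N - int d)"
  by (simp add: balanced_def)

text \<open>The definition covers \<open>c \<le> N\<close>; at \<open>c = N + 1\<close> the symmetry
  gives equality. The two insertion lemmas below need this extra index at the centre.\<close>

lemma balanced_low:
  assumes "balanced s N f" "c \<le> N + 1"
  shows "q ^ s * f (c - 2) \<preceq> f c"
proof (cases "c = N + 1")
  case True
  then show ?thesis
    using assms balanced_sym[OF assms(1), of 1] by simp
next
  case False
  then have "c = N - int (nat (N - c))" using assms by simp
  then show ?thesis
    using assms(1) unfolding balanced_def by metis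
qed

text \<open>Reflection turns growth on the left into decay on the right. The threshold is
  \<open>N - 1\<close> because \<open>f (N + 1)\<close> equals
  \<open>q ^ s * f (N - 1)\<close>.\<close>

lemma balanced_decreasing:
  assumes "balanced s N f"
  shows "decreasing s (N - 1) f"
  unfolding decreasing_def
proof (intro allI impI)
  fix c assume "c \<ge> N - 1"
  define d where "d = nat (c - N + 1)"
  have c: "c = N + int d - 1" using \<open>c \<ge> N - 1\<close> by (simp add: d_def)
  show "f (c + 2) \<preceq> q ^ s * f c"
  proof (cases d)
    case 0
    then show ?thesis
      using c balanced_sym[OF assms, of 1] by (simp add: add.commute)
  next
    case (Suc k)
    have "f (c + 2) = f (N + int (k + 2))"
      using c Suc by (simp add: add.commute add.left_commute)
    also have "\<dots> = q ^ (s * Suc k) * (q ^ s * f (N - int k - 2))"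
      unfolding balanced_sym[OF assms] by (simp add: power_add algebra_simps)
    also have "\<dots> \<preceq> q ^ (s * Suc k) * f (N - int k)"
      using assms by (intro coeff_le_mult_q) (simp add: balanced_def)
    also have "\<dots> = q ^ s * f (N + int k)"
      unfolding balanced_sym[OF assms] by (simp add: power_add algebra_simps)
    also have "N + int k = c"
      using c Suc by simp
    finally show ?thesis .
  qed
qed

text \<open>Multiplication by (1 + zeta q^y)(1 + q^x / zeta). The reflection exchanges the two
  neighbouring terms because y - x = s, and the inequality holds term by term.\<close>

lemma balanced_XY:
  assumes f: "balanced s N f" and y: "y = x + s"
  shows "balanced s N (\<lambda>c. (1 + q ^ (x + y)) * f c + q ^ y * f (c - 1) + q ^ x * f (c + 1))"
    (is "balanced s N ?g")
  unfolding balanced_def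
proof (intro conjI allI)
  fix d
  show "?g (N + int d) = q ^ (s * d) * ?g (N - int d)"
  proof (cases d)
    case (Suc k)
    have e: "N + int d - 1 = N + int k" "N + int d + 1 = N + int (d + 1)"
      "N - int d - 1 = N - int (d + 1)" "N - int d + 1 = N - int k"
      using Suc by simp_all
    show ?thesis
      unfolding e balanced_sym[OF f] using y Suc
      by (simp add: algebra_simps power_add)
  qed simp
next
  fix d
  define c where "c = N - int d"
  have "q ^ s * ?g (c - 2) = (1 + q ^ (x + y)) * (q ^ s * f (c - 2)) + q ^ y * (q ^ s * f (c - 1 - 2))
      + q ^ x * (q ^ s * f (c + 1 - 2))"
    by (simp add: algebra_simps)
  also have "\<dots> \<preceq> ?g c"
    unfolding distrib_right mult_1_left
    by (intro coeff_le_add coeff_le_mult_q balanced_low[OF f]) (simp_all add: c_def)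
  finally show "q ^ s * ?g (N - int d - 2) \<preceq> ?g (N - int d)"
    by (simp add: c_def)
qed

lemma balanced_YY:
  assumes f: "balanced s N f" and y: "y + y' = s"
  shows "balanced s (N + 1) (\<lambda>c. f c + (q ^ y + q ^ y') * f (c - 1) + q ^ s * f (c - 2))"
    (is "balanced s _ ?g")
  unfolding balanced_def
proof (intro conjI allI)
  fix d
  show "?g (N + 1 + int d) = q ^ (s * d) * ?g (N + 1 - int d)"
  proof (cases d)
    case (Suc k)
    have e: "N + 1 + int d = N + int (d + 1)" "N + 1 - int d = N - int k"
      and e': "N + int (d + 1) - 1 = N + int d" "N + int (d + 1) - 2 = N + int k"
      "N - int k - 1 = N - int d" "N - int k - 2 = N - int (d + 1)"
      using Suc by simp_all
    show ?thesis
      unfolding e unfolding e' balanced_sym[OF f] using y Suc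
      by (simp add: algebra_simps power_add)
  qed simp
next
  fix d
  define c where "c = N + 1 - int d"
  have "q ^ s * ?g (c - 2) = q ^ s * f (c - 2) + (q ^ y + q ^ y') * (q ^ s * f (c - 1 - 2))
      + q ^ s * (q ^ s * f (c - 2 - 2))"
    by (simp add: algebra_simps)
  also have "\<dots> \<preceq> ?g c"
    unfolding distrib_right
    by (intro coeff_le_add coeff_le_mult_q balanced_low[OF f]) (simp_all add: c_def)
  finally show "q ^ s * ?g (N + 1 - int d - 2) \<preceq> ?g (N + 1 - int d)"
    by (simp add: c_def)
qed

text \<open>The recurrence reaches back to index \<open>c - 1\<close>, so each unmatched element of
  \<open>Y\<close> raises the threshold by one. Elements of \<open>X\<close> lead to
  \<open>c + 1\<close> and cost nothing.\<close>

lemma decreasing_insert_Y: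
  assumes "decreasing s c0 (pair_gf A B)" "finite A" "finite B" "b \<notin> B"
  shows "decreasing s (c0 + 1) (pair_gf A (insert b B))"
  unfolding decreasing_def
proof (intro allI impI)
  fix c assume "c \<ge> c0 + 1"
  have "pair_gf A (insert b B) (c + 2) = pair_gf A B (c + 2) + q ^ b * pair_gf A B (c - 1 + 2)"
    using assms by (simp add: pair_gf_insert_right)
  also have "\<dots> \<preceq> q ^ s * pair_gf A B c + q ^ b * (q ^ s * pair_gf A B (c - 1))"
    using \<open>c \<ge> c0 + 1\<close>
    by (intro coeff_le_add coeff_le_mult_q decreasingD[OF assms(1)]) auto
  also have "\<dots> = q ^ s * pair_gf A (insert b B) c"
    using assms by (simp add: pair_gf_insert_right algebra_simps)
  finally show "pair_gf A (insert b B) (c + 2) \<preceq> q ^ s * pair_gf A (insert b B) c" .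
qed

lemma decreasing_insert_X:
  assumes "decreasing s c0 (pair_gf A B)" "finite A" "finite B" "a \<notin> A"
  shows "decreasing s c0 (pair_gf (insert a A) B)"
  unfolding decreasing_def
proof (intro allI impI)
  fix c assume "c \<ge> c0"
  have "pair_gf (insert a A) B (c + 2) = pair_gf A B (c + 2) + q ^ a * pair_gf A B (c + 1 + 2)"
    using assms by (simp add: pair_gf_insert_left add.commute add.left_commute)
  also have "\<dots> \<preceq> q ^ s * pair_gf A B c + q ^ a * (q ^ s * pair_gf A B (c + 1))"
    using \<open>c \<ge> c0\<close>
    by (intro coeff_le_add coeff_le_mult_q decreasingD[OF assms(1)]) auto
  also have "\<dots> = q ^ s * pair_gf (insert a A) B c"
    using assms by (simp add: pair_gf_insert_left algebra_simps)
  finally show "pair_gf (insert a A) B (c + 2) \<preceq> q ^ s * pair_gf (insert a A) B c" .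
qed

lemma decreasing_union_Y:
  assumes "finite B'" "decreasing s c0 (pair_gf A B)" "finite A" "finite B" "B \<inter> B' = {}"
  shows "decreasing s (c0 + int (card B')) (pair_gf A (B \<union> B'))"
  using assms
proof (induction B' rule: finite_induct)
  case (insert b B')
  then have "decreasing s (c0 + int (card B') + 1) (pair_gf A (insert b (B \<union> B')))"
    by (intro decreasing_insert_Y) auto
  then show ?case using insert by (simp add: algebra_simps)
qed simp

lemma decreasing_union_X:
  assumes "finite A'" "decreasing s c0 (pair_gf A B)" "finite A" "finite B" "A \<inter> A' = {}"
  shows "decreasing s c0 (pair_gf (A \<union> A') B)"
  using assms
proof (induction A' rule: finite_induct)
  case (insert a A')
  then have "decreasing s c0 (pair_gf (insert a (A \<union> A')) B)"
    by (intro decreasing_insert_X) auto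
  then show ?case by simp
qed simp

lemma balanced_empty: "balanced s 0 (pair_gf {} {})"
  by (auto simp: balanced_def pair_gf_empty coeff_le_def)

lemma balanced_pairs_YY:
  assumes "finite I" "I \<subseteq> {1..<m}"
  shows "balanced (2 * m) (int (card I)) (pair_gf {} ((\<lambda>i. m + i) ` I \<union> (\<lambda>i. m - i) ` I))"
  using assms
proof (induction I rule: finite_induct)
  case empty
  then show ?case by (simp add: balanced_empty)
next
  case (insert i I)
  let ?B = "(\<lambda>i. m + i) ` I \<union> (\<lambda>i. m - i) ` I"
  have 1: "m - i \<notin> ?B"
    using insert by (auto simp: subset_iff) (metis diff_diff_cancel less_imp_le_nat)
  have 2: "m + i \<notin> insert (m - i) ?B"
    using insert by (auto simp: subset_iff)
  have eq: "(\<lambda>i. m + i) ` insert i I \<union> (\<lambda>i. m - i) ` insert i I = insert (m + i) (insert (m - i) ?B)"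
    by auto
  have "pair_gf {} (insert (m + i) (insert (m - i) ?B)) =
    (\<lambda>c. pair_gf {} ?B c + (q ^ (m - i) + q ^ (m + i)) * pair_gf {} ?B (c - 1) + q ^ (2 * m) * pair_gf {} ?B (c - 2))"
  proof
    fix c
    have "q ^ (m + i) * q ^ (m - i) = q ^ (2 * m)"
      using insert by (simp flip: power_add)
    then have "q ^ (m + i) * (q ^ (m - i) * f) = q ^ (2 * m) * f" for f
      by (metis mult.assoc)
    then show "pair_gf {} (insert (m + i) (insert (m - i) ?B)) c =
      pair_gf {} ?B c + (q ^ (m - i) + q ^ (m + i)) * pair_gf {} ?B (c - 1) + q ^ (2 * m) * pair_gf {} ?B (c - 2)"
      using insert 1 2 by (simp add: pair_gf_insert_right algebra_simps)
  qed
  moreover have "balanced (2 * m) (int (card I) + 1) \<dots>"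
    using insert by (intro balanced_YY) auto
  ultimately show ?case
    unfolding eq using insert by (simp add: add.commute)
qed

lemma pair_gf_insert_XY:
  assumes "finite A" "finite B" "x \<notin> A" "y \<notin> B"
  shows "pair_gf (insert x A) (insert y B) =
    (\<lambda>c. (1 + q ^ (x + y)) * pair_gf A B c + q ^ y * pair_gf A B (c - 1) + q ^ x * pair_gf A B (c + 1))"
  using assms
  by (auto simp: fun_eq_iff pair_gf_insert_right pair_gf_insert_left algebra_simps power_add)

lemma balanced_pairs_XY:
  assumes "finite J" "balanced s N (pair_gf A B)" "finite A" "finite B" "A \<inter> J = {}" "B \<inter> (\<lambda>x. x + s) ` J = {}"
  shows "balanced s N (pair_gf (A \<union> J) (B \<union> (\<lambda>x. x + s) ` J))"
  using assms
proof (induction J rule: finite_induct)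
  case (insert x J)
  have "balanced s N (pair_gf (insert x (A \<union> J)) (insert (x + s) (B \<union> (\<lambda>x. x + s) ` J)))"
    using insert by (subst pair_gf_insert_XY) (auto intro!: balanced_XY)
  then show ?case by simp
qed simp

subsection \<open>The brackets for positive m\<close>

lemma decreasing_mono: "decreasing s c0 f \<Longrightarrow> c0 \<le> c1 \<Longrightarrow> decreasing s c1 f"
  by (simp add: decreasing_def)

lemma balanced_pairs:
  assumes "I \<subseteq> {1..<m}" "finite J" "0 \<notin> J"
  shows "balanced (2 * m) (int (card I))
    (pair_gf J ((\<lambda>i. m + i) ` I \<union> (\<lambda>i. m - i) ` I \<union> (\<lambda>x. x + 2 * m) ` J))"
proof -
  have "finite I" using assms(1) finite_subset by blast
  have "(\<lambda>i. m + i) ` I \<union> (\<lambda>i. m - i) ` I \<subseteq> {..<2 * m}"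
    using assms(1) by force
  moreover have "(\<lambda>x. x + 2 * m) ` J \<inter> {..<2 * m} = {}"
    by auto
  ultimately have "((\<lambda>i. m + i) ` I \<union> (\<lambda>i. m - i) ` I) \<inter> (\<lambda>x. x + 2 * m) ` J = {}"
    by blast
  then show ?thesis
    using balanced_pairs_XY[OF assms(2) balanced_pairs_YY[OF \<open>finite I\<close> assms(1)]] \<open>finite I\<close>
    by simp
qed

text \<open>Under reflection about \<open>m\<close>, an element y of \<open>Y\<close> is matched
  with 2m - y in \<open>Y\<close>, or with x = y - 2m in \<open>X\<close>. The cases differ in which
  mirror images exist; counting the unmatched elements of \<open>Y\<close> gives the thresholds m, m
  - 1 and m - 2.\<close>

lemma decreasing_center:
  fixes n m :: nat
  assumes "m \<ge> 1"
  shows "decreasing (2 * m) (int m) (pair_gf {2..n} ({1..n + m} - {m}))"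
proof -
  have YY: "(\<lambda>i. m + i) ` {1..<r} \<union> (\<lambda>i. m - i) ` {1..<r} = {m - r <..<m} \<union> {m<..<m + r}"
    if "r \<le> m" for r
  proof -
    have "(\<lambda>i. m + i) ` {1..<r} = {m<..<m + r}"
      using image_add_atLeastLessThan[of m 1 r] by (auto simp: atLeastSucLessThan_greaterThanLessThan)
    moreover have "(\<lambda>i. m - i) ` {1..<r} = {m - r <..<m}"
    proof (intro equalityI subsetI)
      fix y assume y: "y \<in> {m - r <..<m}"
      show "y \<in> (\<lambda>i. m - i) ` {1..<r}"
      proof (rule image_eqI)
        show "y = m - (m - y)" using y by simp
        show "m - y \<in> {1..<r}" using y that by simp linarith
      qed
    qed (use that in auto)
    ultimately show ?thesis by blast
  qed
  consider "n > m" | "n = m" | "n < m" by linarith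
  then show ?thesis
  proof cases
    case 1
    let ?B = "{0<..<m} \<union> {m<..<2 * m} \<union> {2 * m + 2..n + m}"
    have J: "(\<lambda>x. x + 2 * m) ` {2..n - m} = {2 * m + 2..n + m}"
      using 1 by (simp only: image_add_atLeastAtMost') (simp add: mult_2)
    \<comment> \<open>The mirror images of \<open>2 m\<close> and \<open>2 m + 1\<close> would be the positions \<open>0\<close> and \<open>-1\<close>, which do not exist.\<close>
    have "balanced (2 * m) (int (m - 1)) (pair_gf {2..n - m} ?B)"
      using balanced_pairs[of "{1..<m}" m "{2..n - m}"] unfolding YY[OF order_refl] J
      by (simp add: mult_2)
    then have "decreasing (2 * m) (int (m - 1) - 1) (pair_gf {2..n - m} ?B)"
      by (rule balanced_decreasing)
    then have "decreasing (2 * m) (int (m - 1) - 1 + int (card {2 * m, 2 * m + 1}))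
      (pair_gf ({2..n - m} \<union> {n - m + 1..n}) (?B \<union> {2 * m, 2 * m + 1}))"
      by (intro decreasing_union_Y decreasing_union_X) auto
    also have "{2..n - m} \<union> {n - m + 1..n} = {2..n}"
      using 1 by auto
    also have "?B \<union> {2 * m, 2 * m + 1} = {1..n + m} - {m}"
      using 1 assms by auto
    finally show ?thesis
      using assms by (simp add: of_nat_diff)
  next
    case 2
    let ?B = "{0<..<m} \<union> {m<..<2 * m}"
    have "balanced (2 * m) (int (m - 1)) (pair_gf {} ?B)"
      using balanced_pairs[of "{1..<m}" m "{}"] unfolding YY[OF order_refl] by (simp add: mult_2)
    then have "decreasing (2 * m) (int (m - 1) - 1) (pair_gf {} ?B)"
      by (rule balanced_decreasing)
    then have "decreasing (2 * m) (int (m - 1) - 1 + int (card {2 * m}))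
      (pair_gf ({} \<union> {2..n}) (?B \<union> {2 * m}))"
      by (intro decreasing_union_Y decreasing_union_X) auto
    also have "?B \<union> {2 * m} = {1..n + m} - {m}"
      using 2 assms by auto
    finally show ?thesis
      using assms by (auto elim: decreasing_mono)
  next
    case 3
    \<comment> \<open>Only distances up to \<open>n\<close> from the centre fit; the elements below
      m - n have mirror images above n + m, outside \<open>Y\<close>.\<close>
    let ?B = "{m - Suc n <..<m} \<union> {m<..<m + Suc n}"
    have "balanced (2 * m) (int n) (pair_gf {} ?B)"
      using balanced_pairs[of "{1..<Suc n}" m "{}"] YY[of "Suc n"] 3 by simp
    then have "decreasing (2 * m) (int n - 1) (pair_gf {} ?B)"
      by (rule balanced_decreasing)
    then have "decreasing (2 * m) (int n - 1 + int (card {1..m - Suc n}))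
      (pair_gf ({} \<union> {2..n}) (?B \<union> {1..m - Suc n}))"
      by (intro decreasing_union_Y decreasing_union_X) auto
    also have "?B \<union> {1..m - Suc n} = {1..n + m} - {m}"
      using 3 by auto
    finally show ?thesis
      using assms 3 by (auto elim!: decreasing_mono)
  qed
qed

text \<open>Restoring the fixed point \<open>m\<close> of the reflection multiplies by 1 + zeta q^m.
  The term \<open>q ^ m * ?f (int m + 1)\<close> is common to both sides, so the two-step bound for
  \<open>?f\<close> becomes a one-step bound.\<close>

lemma pair_gf_step:
  fixes n m :: nat
  assumes "m \<ge> 1"
  shows "pair_gf {2..n} {1..n + m} (int m + 2) \<preceq> q ^ m * pair_gf {2..n} {1..n + m} (int m + 1)"
proof -
  let ?f = "pair_gf {2..n} ({1..n + m} - {m})"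
  have "pair_gf {2..n} (insert m ({1..n + m} - {m})) c = ?f c + q ^ m * ?f (c - 1)" for c
    by (rule pair_gf_insert_right) auto
  moreover have "insert m ({1..n + m} - {m}) = {1..n + m}"
    using assms by auto
  ultimately have Z: "pair_gf {2..n} {1..n + m} c = ?f c + q ^ m * ?f (c - 1)" for c
    by simp
  have "?f (int m + 2) + q ^ m * ?f (int m + 1) \<preceq> q ^ (2 * m) * ?f (int m) + q ^ m * ?f (int m + 1)"
    by (intro coeff_le_add coeff_le_refl decreasingD[OF decreasing_center[OF assms]]) simp
  also have "\<dots> = q ^ m * pair_gf {2..n} {1..n + m} (int m + 1)"
    unfolding Z by (simp add: algebra_simps mult_2 flip: power_add)
  finally show ?thesis unfolding Z by (simp add: add.commute)
qed

text \<open>Now x is matched with y = x, that is \<open>s = 0\<close>. The \<open>m\<close>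
  unmatched elements 1 and n + 2, ..., n + m of \<open>Y\<close> lift the threshold from -1 to m -
  1.\<close>

lemma pair_gf_flip:
  fixes n m :: nat
  assumes "m \<ge> 1"
  shows "pair_gf {2..Suc n} {1..n + m} (int m + 1) \<preceq> pair_gf {2..Suc n} {1..n + m} (int m - 1)"
proof -
  have "balanced 0 0 (pair_gf {2..Suc n} {2..Suc n})"
    using balanced_pairs_XY[OF _ balanced_empty[of 0], of "{2..Suc n}"] by simp
  then have "decreasing 0 (0 - 1) (pair_gf {2..Suc n} {2..Suc n})"
    by (rule balanced_decreasing)
  then have "decreasing 0 (0 - 1 + int (card (insert 1 {n + 2..n + m})))
      (pair_gf {2..Suc n} ({2..Suc n} \<union> insert 1 {n + 2..n + m}))"
    by (intro decreasing_union_Y) auto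
  also have "{2..Suc n} \<union> insert 1 {n + 2..n + m} = {1..n + m}"
    using assms by auto
  finally have "decreasing 0 (int m - 1) (pair_gf {2..Suc n} {1..n + m})"
    using assms by (auto elim!: decreasing_mono)
  from decreasingD[OF this, of "int m - 1"] show ?thesis
    by (simp add: add.commute)
qed

text \<open>Chains the two comparisons; enlarging \<open>X\<close> by \<open>n + 1\<close> in
  between only adds nonnegative terms.\<close>

lemma pair_gf_bracket_le:
  fixes n m :: nat
  assumes "m \<ge> 1"
  shows "pair_gf {2..n} {1..n + m} (int m + 2) \<preceq> q ^ m * pair_gf {2..Suc n} {1..n + m} (int m - 1)"
proof -
  have "pair_gf {2..n} {1..n + m} c \<preceq> pair_gf {2..Suc n} {1..n + m} c" for c
  proof (cases "n = 0")
    case False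
    then have "{2..Suc n} = insert (Suc n) {2..n}" by auto
    then have "pair_gf {2..Suc n} {1..n + m} c =
        pair_gf {2..n} {1..n + m} c + q ^ Suc n * pair_gf {2..n} {1..n + m} (c + 1)"
      by (simp only:) (rule pair_gf_insert_left, auto)
    then show ?thesis
      using nonneg_mult_q[OF pair_gf_nonneg, of "Suc n" "{2..n}" "{1..n + m}" "c + 1"]
      by (simp add: coeff_le_def)
  qed simp
  then show ?thesis
    by (meson assms coeff_le_mult_q coeff_le_trans pair_gf_flip pair_gf_step)
qed

subsection \<open>The brackets for m = 0\<close>

text \<open>Swapping the two sets and then shifting returns to the same pair of sets: a symmetry
  about 0 with \<open>s = 1\<close>.\<close>

lemma pair_gf_diag_sym:
  assumes "finite C"
  shows "pair_gf (Suc ` C) C (- int c) = q ^ c * pair_gf (Suc ` C) C (int c)"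
  using pair_gf_shift[OF assms assms, of c] pair_gf_swap[of C "Suc ` C" "int c"] by simp

text \<open>Enlarging \<open>X\<close> in the subtracted term lets both terms use the same sets.
  After splitting off 1 from \<open>Y\<close> and 2 from \<open>X\<close>, the symmetry of
  \<open>?G\<close> cancels all but a difference suited to the matching y = x + 2.\<close>

lemma pair_gf_bracket_zero_ge:
  assumes "n \<ge> 1"
  shows "q\<^sup>2 * pair_gf {2..Suc n} {2..n} 0 - pair_gf {2..Suc n} {2..n} 2
    \<preceq> pair_gf {2..Suc n} {1..n} (- 1) - pair_gf {2..n} {1..n} 2"
proof -
  let ?G = "pair_gf {3..Suc n} {2..n}"
  have Y: "{1..n} = insert 1 {2..n}" and X: "{2..Suc n} = insert 2 {3..Suc n}"
    and X': "{2..Suc n} = insert (Suc n) {2..n}"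
    using assms by auto
  have Q: "pair_gf {2..Suc n} {2..n} c = ?G c + q\<^sup>2 * ?G (c + 1)" for c
    unfolding X by (rule pair_gf_insert_left) auto
  have R: "pair_gf {2..Suc n} {1..n} c = pair_gf {2..Suc n} {2..n} c + q * pair_gf {2..Suc n} {2..n} (c - 1)" for c
    unfolding Y using pair_gf_insert_right[of "{2..Suc n}" "{2..n}" 1 c] by simp
  have "Suc ` {2..n} = {3..Suc n}"
    by (simp add: image_Suc_atLeastAtMost)
  with pair_gf_diag_sym[of "{2..n}" 1] pair_gf_diag_sym[of "{2..n}" 2]
  have G: "?G (- 1) = q * ?G 1" "?G (- 2) = q\<^sup>2 * ?G 2"
    by simp_all
  have "pair_gf {2..Suc n} {1..n} 2 = pair_gf {2..n} {1..n} 2 + q ^ Suc n * pair_gf {2..n} {1..n} 3"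
    unfolding X' using pair_gf_insert_left[of "{2..n}" "{1..n}" "Suc n" 2] by simp
  then have "pair_gf {2..n} {1..n} 2 \<preceq> pair_gf {2..Suc n} {1..n} 2"
    using nonneg_mult_q[OF pair_gf_nonneg, of "Suc n" "{2..n}" "{1..n}" 3]
    by (simp add: coeff_le_def)
  then have "pair_gf {2..Suc n} {1..n} (- 1) - pair_gf {2..Suc n} {1..n} 2
    \<preceq> pair_gf {2..Suc n} {1..n} (- 1) - pair_gf {2..n} {1..n} 2"
    by (simp add: coeff_le_def)
  moreover have "pair_gf {2..Suc n} {1..n} (- 1) - pair_gf {2..Suc n} {1..n} 2
    = q\<^sup>2 * pair_gf {2..Suc n} {2..n} 0 - pair_gf {2..Suc n} {2..n} 2"
    unfolding R unfolding Q by (simp add: G algebra_simps power2_eq_square)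
  ultimately show ?thesis by simp
qed

text \<open>
  The possible elements \<open>x\<close> and \<open>y = x + 2\<close> of \<open>X \<subseteq> {2..n+1}\<close> and \<open>Y \<subseteq> {2..n}\<close> that can be matched;
  \<open>2\<close>, \<open>3\<close> in \<open>Y\<close> and \<open>n - 1\<close>, \<open>n\<close>, \<open>n + 1\<close> in \<open>X\<close> remain unmatched.
\<close>

definition core_gf :: "nat \<Rightarrow> int \<Rightarrow> real fps" where
  "core_gf n = pair_gf {2..n - 2} {4..n}"

text \<open>\<open>core_M\<close> and \<open>core_O\<close> are the steps of the balanced sequence
  \<open>core_gf n\<close> that end at its centre 0 and at -1.\<close>

definition core_M :: "nat \<Rightarrow> real fps" where
  "core_M n = core_gf n 0 - q\<^sup>2 * core_gf n (- 2)"

definition core_O :: "nat \<Rightarrow> real fps" where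
  "core_O n = core_gf n (- 1) - q\<^sup>2 * core_gf n (- 3)"

lemma core_gf_3: "core_gf 3 c = (if c = 0 then 1 else 0)"
  by (simp add: core_gf_def pair_gf_empty)

lemma core_gf_Suc:
  assumes "n \<ge> 3"
  shows "core_gf (Suc n) c =
    (1 + q ^ (2 * n)) * core_gf n c + q ^ (n + 1) * core_gf n (c - 1) + q ^ (n - 1) * core_gf n (c + 1)"
proof -
  have "{2..Suc n - 2} = insert (n - 1) {2..n - 2}" "{4..Suc n} = insert (n + 1) {4..n}"
    using assms by auto
  moreover have "n - 1 + (n + 1) = 2 * n" using assms by simp
  ultimately show ?thesis
    unfolding core_gf_def by (simp only:) (subst pair_gf_insert_XY, auto)
qed

lemma balanced_core_gf:
  assumes "n \<ge> 3"
  shows "balanced 2 0 (core_gf n)"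
proof -
  have *: "(\<lambda>x. x + 2) ` {2..n - 2} = {4..n}"
    using assms unfolding image_add_atLeastAtMost' by auto
  show ?thesis
    using balanced_pairs_XY[OF _ balanced_empty[of 2], of "{2..n - 2}"] unfolding *
    by (simp add: core_gf_def)
qed

lemma core_gf_1: "n \<ge> 3 \<Longrightarrow> core_gf n 1 = q\<^sup>2 * core_gf n (- 1)"
  using balanced_sym[OF balanced_core_gf, of n 1] by simp

lemma core_M_nonneg: "n \<ge> 3 \<Longrightarrow> 0 \<preceq> core_M n"
  using balanced_low[OF balanced_core_gf, of n 0] by (simp add: core_M_def coeff_le_diff_iff)

lemma core_O_nonneg: "n \<ge> 3 \<Longrightarrow> 0 \<preceq> core_O n"
  using balanced_low[OF balanced_core_gf, of n "- 1"] by (simp add: core_O_def coeff_le_diff_iff)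

text \<open>By \<open>core_gf_1\<close> the new term at index 1 equals the subtracted one at index
  -1, so only \<open>core_O n\<close> is left.\<close>

lemma core_M_Suc:
  "n \<ge> 3 \<Longrightarrow> core_M (Suc n) = (1 + q ^ (2 * n)) * core_M n + q ^ (n + 1) * core_O n"
  by (simp add: core_M_def core_O_def core_gf_Suc core_gf_1 algebra_simps)

lemma core_O_Suc:
  assumes "n \<ge> 3"
  shows "core_O n + q ^ (n - 1) * core_M n \<preceq> core_O (Suc n)"
proof -
  have "core_O (Suc n) = core_O n + q ^ (n - 1) * core_M n + (q ^ (2 * n) * core_O n
      + q ^ (n + 1) * (core_gf n (- 2) - q\<^sup>2 * core_gf n (- 4)))"
    using assms by (simp add: core_M_def core_O_def core_gf_Suc algebra_simps)
  moreover have "0 \<preceq> core_gf n (- 2) - q\<^sup>2 * core_gf n (- 4)"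
    using balanced_low[OF balanced_core_gf, of n "- 2"] assms by (simp add: coeff_le_diff_iff)
  then have "0 \<preceq> q ^ (2 * n) * core_O n + q ^ (n + 1) * (core_gf n (- 2) - q\<^sup>2 * core_gf n (- 4))"
    using assms by (intro nonneg_add nonneg_mult_q core_O_nonneg)
  ultimately show ?thesis
    by (simp add: coeff_le_def)
qed

lemma core_M_3 [simp]: "core_M 3 = 1"
  by (simp add: core_M_def core_gf_3)

lemma core_O_3 [simp]: "core_O 3 = 0"
  by (simp add: core_O_def core_gf_3)

lemma core_M_ge_1: "n \<ge> 3 \<Longrightarrow> 1 \<preceq> core_M n"
proof (induction n rule: nat_induct_at_least)
  case (Suc n)
  have "0 \<preceq> q ^ (2 * n) * core_M n + q ^ (n + 1) * core_O n"
    using Suc by (intro nonneg_add nonneg_mult_q core_O_nonneg core_M_nonneg)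
  with Suc.IH have "1 + 0 \<preceq> core_M n + (q ^ (2 * n) * core_M n + q ^ (n + 1) * core_O n)"
    by (rule coeff_le_add)
  then show ?case
    using Suc.hyps by (simp add: core_M_Suc algebra_simps)
qed simp

text \<open>Lets the negative term \<open>q ^ 5 * core_M n\<close> of one bracket be paid by
  \<open>q\<^sup>2 * core_M (Suc n)\<close> of the next, where the weight has two more powers of q.
  The constant 1 is split off because \<open>core_M (Suc 3) = 1 + q ^ 6\<close> does not dominate
  \<open>q * core_M 3 = q\<close>.\<close>

lemma core_M_growth: "n \<ge> 3 \<Longrightarrow> 0 \<preceq> (core_M (Suc n) - 1) - q * (core_M n - 1)"
proof (induction n rule: nat_induct_at_least)
  case base
  have "core_M (Suc 3) = 1 + q ^ 6"
    by (subst core_M_Suc) simp_all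
  then show ?case by simp
next
  case (Suc n)
  \<comment> \<open>The recurrences express the increment of the claimed difference;
    \<open>core_O_Suc\<close> is exactly what makes its last term nonnegative.\<close>
  have "(core_M (Suc (Suc n)) - 1) - q * (core_M (Suc n) - 1)
    = ((core_M (Suc n) - 1) - q * (core_M n - 1)) + (q ^ (2 * n + 2) * core_M (Suc n)
      + q ^ (n + 2) * (core_O (Suc n) - (core_O n + q ^ (n - 1) * core_M n)))"
  proof -
    have "q ^ (n + 2) * q ^ (n - 1) = q ^ (2 * n + 1)"
      using Suc.hyps by (subst power_add[symmetric]) (rule arg_cong[where f = "power q"], simp)
    then have e: "q ^ (n + 2) * (q ^ (n - 1) * core_M n) = q ^ (2 * n + 1) * core_M n"
      by (metis mult.assoc)
    have "core_M (Suc (Suc n)) = core_M (Suc n) + q ^ (2 * n + 2) * core_M (Suc n) + q ^ (n + 2) * core_O (Suc n)"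
      using core_M_Suc[of "Suc n"] Suc.hyps by (simp add: algebra_simps)
    moreover have "q * core_M (Suc n) = q * core_M n + q ^ (2 * n + 1) * core_M n + q ^ (n + 2) * core_O n"
      using core_M_Suc[of n] Suc.hyps by (simp add: algebra_simps)
    ultimately show ?thesis
      using e by (simp add: algebra_simps)
  qed
  also have "0 \<preceq> \<dots>"
    using Suc core_O_Suc[of n]
    by (intro nonneg_add nonneg_mult_q core_M_nonneg) (auto simp: coeff_le_diff_iff)
  finally show ?case .
qed

text \<open>\<open>d\<close> and \<open>e\<close> are the differences before and after 2 and 3 enter
  \<open>Y\<close>; insertion acts linearly on them. Choosing just one of n - 1, n, n + 1 in
  \<open>X\<close> gives \<open>e 1\<close>, hence the three extra powers.\<close>

lemma pair_gf_bracket_zero_core: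
  assumes n: "n \<ge> 3"
  shows "(q\<^sup>2 - q ^ 5) * core_M n + (q ^ (n + 3) + q ^ (n + 4) + q ^ (n + 5))
    \<preceq> q\<^sup>2 * pair_gf {2..Suc n} {2..n} 0 - pair_gf {2..Suc n} {2..n} 2"
proof -
  define f where "f = core_gf n"
  define g where "g = pair_gf {2..n - 2} {2..n}"
  define d where "d c = q\<^sup>2 * f c - f (c + 2)" for c
  define e where "e c = q\<^sup>2 * g c - g (c + 2)" for c
  have Y: "{2..n} = insert 2 (insert 3 {4..n})"
    and X: "{2..Suc n} = insert (n + 1) (insert n (insert (n - 1) {2..n - 2}))"
    using n by auto
  have "g c = f c + (q\<^sup>2 + q ^ 3) * f (c - 1) + q ^ 5 * f (c - 2)" for c
  proof -
    have "q\<^sup>2 * (q ^ 3 * h) = q ^ 5 * h" for h :: "real fps"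
      by (simp add: mult.assoc[symmetric] flip: power_add)
    then show ?thesis
      unfolding g_def f_def core_gf_def Y by (simp add: pair_gf_insert_right algebra_simps)
  qed
  then have e: "e c = d c + (q\<^sup>2 + q ^ 3) * d (c - 1) + q ^ 5 * d (c - 2)" for c
    by (simp add: e_def d_def algebra_simps)
  have d_nonneg: "0 \<preceq> d c" if "c \<ge> - 1" for c
    using decreasingD[OF balanced_decreasing[OF balanced_core_gf[OF n]], of c] that
    by (simp add: d_def f_def coeff_le_diff_iff)
  have d0: "d 0 = q\<^sup>2 * core_M n"
    using balanced_sym[OF balanced_core_gf[OF n], of 2]
    by (simp add: d_def f_def core_M_def algebra_simps flip: power_add)
  have d2: "d (- 2) = - core_M n"
    by (simp add: d_def f_def core_M_def)
  have e_nonneg: "0 \<preceq> e c" if "c \<ge> 1" for c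
    unfolding e distrib_right using that by (intro nonneg_add nonneg_mult_q d_nonneg) auto
  \<comment> \<open>The only negative contribution: both \<open>2\<close> and \<open>3\<close> lie in \<open>Y\<close> and no unmatched element lies in \<open>X\<close>.\<close>
  have e0: "(q\<^sup>2 - q ^ 5) * core_M n \<preceq> e 0"
  proof -
    have "e 0 = (q\<^sup>2 - q ^ 5) * core_M n + (q\<^sup>2 + q ^ 3) * d (- 1)"
      by (simp add: e d0 d2 algebra_simps)
    moreover have "0 \<preceq> (q\<^sup>2 + q ^ 3) * d (- 1)"
      unfolding distrib_right by (intro nonneg_add nonneg_mult_q d_nonneg) auto
    ultimately show ?thesis
      by (simp add: coeff_le_def)
  qed
  \<comment> \<open>Taking 2 but not 3 in \<open>Y\<close> contributes
    \<open>q\<^sup>2 * d 0 = q ^ 4 * core_M n\<close>.\<close>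
  have e1: "q ^ 4 \<preceq> e 1"
  proof -
    have "e 1 = q ^ 4 * core_M n + (d 1 + q ^ 3 * d 0 + q ^ 5 * d (- 1))"
      by (simp add: e d0 algebra_simps flip: power_add)
    moreover have "0 \<preceq> d 1 + q ^ 3 * d 0 + q ^ 5 * d (- 1)"
      by (intro nonneg_add nonneg_mult_q d_nonneg) auto
    moreover have "q ^ 4 * 1 \<preceq> q ^ 4 * core_M n"
      by (intro coeff_le_mult_q core_M_ge_1 n)
    ultimately show ?thesis
      using coeff_le_add[of "q ^ 4 * 1" "q ^ 4 * core_M n" 0] by simp
  qed
  have "pair_gf {2..Suc n} {2..n} c = g c + (q ^ (n - 1) + q ^ n + q ^ (n + 1)) * g (c + 1)
     + (q ^ (n - 1 + n) + q ^ (n - 1 + (n + 1)) + q ^ (n + (n + 1))) * g (c + 2)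
     + q ^ (n - 1 + n + (n + 1)) * g (c + 3)" for c
  proof -
    have "n - 1 \<notin> {2..n - 2}" "n \<notin> insert (n - 1) {2..n - 2}"
      "n + 1 \<notin> insert n (insert (n - 1) {2..n - 2})"
      using n by auto
    then show ?thesis
      unfolding g_def X
      by (simp add: pair_gf_insert_left power_add algebra_simps del: insert_iff)
  qed
  then have "q\<^sup>2 * pair_gf {2..Suc n} {2..n} 0 - pair_gf {2..Suc n} {2..n} 2
     = e 0 + (q ^ (n - 1) * e 1 + q ^ n * e 1 + q ^ (n + 1) * e 1)
     + (q ^ (n - 1 + n) * e 2 + q ^ (n - 1 + (n + 1)) * e 2 + q ^ (n + (n + 1)) * e 2
     + q ^ (n - 1 + n + (n + 1)) * e 3)"
    by (simp add: e_def algebra_simps)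
  also have "(q\<^sup>2 - q ^ 5) * core_M n + (q ^ (n - 1) * q ^ 4 + q ^ n * q ^ 4 + q ^ (n + 1) * q ^ 4) + 0 \<preceq> \<dots>"
    using e0 e1 by (intro coeff_le_add coeff_le_mult_q nonneg_add nonneg_mult_q e_nonneg) auto
  also have "q ^ (n - 1) * q ^ 4 = q ^ (n + 3)"
    using n by (simp flip: power_add)
  also have "q ^ (n + 1) * q ^ 4 = q ^ (n + 5)"
    by (subst power_add[symmetric]) (simp add: add.assoc)
  finally show ?thesis
    by (simp add: add.commute add.left_commute flip: power_add)
qed

text \<open>The right side is each power from q^14 to q^(3N+5) exactly once; the exponents on the
  left are distinct and in that range.\<close>

lemma sum_even_powers_le:
  assumes "N \<ge> 3"
  shows "(\<Sum>n=3..<N. q ^ (2 * n + 8)) \<preceq> q ^ 14 + (\<Sum>n=3..<N. q ^ (3 * n + 6) + q ^ (3 * n + 7) + q ^ (3 * n + 8))"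
proof -
  have *: "q ^ 14 + (\<Sum>n=3..<N. q ^ (3 * n + 6) + q ^ (3 * n + 7) + q ^ (3 * n + 8)) = (\<Sum>T=14..<3 * N + 6. q ^ T)"
    using assms
  proof (induction N rule: nat_induct_at_least)
    case (Suc N)
    have "{14..<3 * Suc N + 6} = insert (3 * N + 8) (insert (3 * N + 7) (insert (3 * N + 6) {14..<3 * N + 6}))"
      using Suc.hyps by auto
    then show ?case
      using Suc by (simp add: algebra_simps)
  qed (simp add: numeral_eq_Suc)
  have "(\<Sum>n=3..<N. q ^ (2 * n + 8)) = (\<Sum>T\<in>(\<lambda>n. 2 * n + 8) ` {3..<N}. q ^ T)"
    by (subst sum.reindex) (auto simp: inj_on_def)
  also have "\<dots> \<preceq> (\<Sum>T=14..<3 * N + 6. q ^ T)"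
    unfolding coeff_le_def fps_sum_nth
    by (intro allI sum_mono2) auto
  finally show ?thesis by (simp only: *)
qed

text \<open>Telescoping reduces the negative part to the powers q^(2n+8), which the three extra
  powers per bracket and a q^14 from \<open>B 2\<close> absorb. The bound on \<open>i\<close> cuts
  off the boundary term.\<close>

lemma sum_bracket_zero_nonneg:
  assumes "i \<le> 2 * L"
  shows "0 \<le> fps_nth (\<Sum>n<L. q ^ (2 * n + 3) * (pair_gf {2..Suc n} {1..n} (- 1) - pair_gf {2..n} {1..n} 2)) i"
proof -
  define B where "B n = pair_gf {2..Suc n} {1..n} (- 1) - pair_gf {2..n} {1..n} 2" for n
  have B0: "B 0 = 0"
    by (simp add: B_def pair_gf_empty)
  have B1: "0 \<preceq> B 1"
  proof -
    have "pair_gf {2..Suc 1} {2..1} 2 = 0"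
      by (rule pair_gf_zero) auto
    then have "0 \<preceq> q\<^sup>2 * pair_gf {2..Suc 1} {2..1} 0 - pair_gf {2..Suc 1} {2..1} 2"
      using nonneg_mult_q[OF pair_gf_nonneg] by simp
    also have "\<dots> \<preceq> B 1"
      unfolding B_def by (rule pair_gf_bracket_zero_ge) simp
    finally show ?thesis .
  qed
  have B2: "q ^ 7 \<preceq> B 2"
  proof -
    have "{2..Suc 2} = insert 2 (insert 3 ({} :: nat set))" "{2..2} = insert 2 ({} :: nat set)"
      by auto
    then have "pair_gf {2..Suc 2} {2..2} 0 = 1 + q ^ 4 + q ^ 5" "pair_gf {2..Suc 2} {2..2} 2 = 0"
      by (simp_all add: pair_gf_insert_right pair_gf_insert_left pair_gf_empty algebra_simps flip: power_add)
    with pair_gf_bracket_zero_ge[of 2] have "q\<^sup>2 * (1 + q ^ 4 + q ^ 5) \<preceq> B 2"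
      by (simp add: B_def)
    also have "q\<^sup>2 * (1 + q ^ 4 + q ^ 5) = q\<^sup>2 + q ^ 6 + q ^ 7"
      by (simp add: algebra_simps flip: power_add)
    finally have "q\<^sup>2 + q ^ 6 + q ^ 7 \<preceq> B 2" .
    moreover have "0 + 0 + q ^ 7 \<preceq> q\<^sup>2 + q ^ 6 + q ^ 7"
      by (intro coeff_le_add) auto
    then have "q ^ 7 \<preceq> q\<^sup>2 + q ^ 6 + q ^ 7" by simp
    ultimately show ?thesis
      by (rule coeff_le_trans[rotated])
  qed
  have B3: "(q\<^sup>2 - q ^ 5) * core_M n + (q ^ (n + 3) + q ^ (n + 4) + q ^ (n + 5)) \<preceq> B n" if "n \<ge> 3" for n
    using coeff_le_trans[OF pair_gf_bracket_zero_core[OF that] pair_gf_bracket_zero_ge] that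
    unfolding B_def by simp
  show ?thesis
  proof (cases "L \<ge> 3")
    case False
    have "0 \<preceq> B n" if "n < L" for n
    proof -
      have "n = 0 \<or> n = 1" using that False by linarith
      then show ?thesis using B0 B1 by auto
    qed
    then have "0 \<preceq> (\<Sum>n<L. q ^ (2 * n + 3) * B n)"
      by (intro nonneg_sum nonneg_mult_q) auto
    then show ?thesis
      by (simp add: coeff_le_def B_def)
  next
    case True
    define M where "M = core_M"
    \<comment> \<open>\<open>core_M_growth\<close> makes the sum telescope. The boundary terms are
      \<open>q ^ (2 * 3 + 5) * M 3 = q ^ 11\<close> and
      \<open>q ^ (2 * L + 5) * M L\<close>.\<close>
    have tele: "(\<Sum>n=3..<L. q ^ (2 * n + 7)) - (\<Sum>n=3..<L. q ^ (2 * n + 8)) + q ^ 11 - q ^ (2 * L + 5) * M L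
      \<preceq> (\<Sum>n=3..<L. q ^ (2 * n + 3) * ((q\<^sup>2 - q ^ 5) * M n))"
      using True
    proof (induction L rule: nat_induct_at_least)
      case base
      then show ?case by (simp add: M_def)
    next
      case (Suc N)
      let ?t = "q ^ (2 * N + 7) * ((M (Suc N) - 1) - q * (M N - 1))"
      have "0 \<preceq> ?t"
        using core_M_growth Suc.hyps by (intro nonneg_mult_q) (simp add: M_def)
      moreover have "q ^ (2 * N + 3) * ((q\<^sup>2 - q ^ 5) * M N) =
          ?t + (q ^ (2 * N + 7) - q ^ (2 * N + 8) - q ^ (2 * N + 7) * M (Suc N) + q ^ (2 * N + 5) * M N)"
        by (simp add: algebra_simps power_add power2_eq_square numeral_eq_Suc)
      ultimately have "q ^ (2 * N + 7) - q ^ (2 * N + 8) - q ^ (2 * N + 7) * M (Suc N) + q ^ (2 * N + 5) * M N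
          \<preceq> q ^ (2 * N + 3) * ((q\<^sup>2 - q ^ 5) * M N)"
        by (simp add: coeff_le_def)
      from coeff_le_add[OF Suc.IH this] show ?case
        using Suc.hyps by (simp add: algebra_simps)
    qed
    have "(\<Sum>n<L. q ^ (2 * n + 3) * B n) = (\<Sum>n<3. q ^ (2 * n + 3) * B n) + (\<Sum>n=3..<L. q ^ (2 * n + 3) * B n)"
      using True by (simp add: lessThan_atLeast0 sum.atLeastLessThan_concat)
    also have "(\<Sum>n<3. q ^ (2 * n + 3) * B n) = q ^ 5 * B 1 + q ^ 7 * B 2"
      by (simp add: eval_nat_numeral B0)
    finally have S: "(\<Sum>n<L. q ^ (2 * n + 3) * B n) = q ^ 5 * B 1 + q ^ 7 * B 2 + (\<Sum>n=3..<L. q ^ (2 * n + 3) * B n)" .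
    have "(\<Sum>n=3..<L. q ^ (2 * n + 3) * ((q\<^sup>2 - q ^ 5) * M n + (q ^ (n + 3) + q ^ (n + 4) + q ^ (n + 5))))
       \<preceq> (\<Sum>n=3..<L. q ^ (2 * n + 3) * B n)"
      using B3 by (intro coeff_le_sum coeff_le_mult_q) (auto simp: M_def)
    moreover have "(\<Sum>n=3..<L. q ^ (2 * n + 3) * ((q\<^sup>2 - q ^ 5) * M n + (q ^ (n + 3) + q ^ (n + 4) + q ^ (n + 5))))
      = (\<Sum>n=3..<L. q ^ (2 * n + 3) * ((q\<^sup>2 - q ^ 5) * M n)) + (\<Sum>n=3..<L. q ^ (3 * n + 6) + q ^ (3 * n + 7) + q ^ (3 * n + 8))"
      unfolding sum.distrib[symmetric]
      by (intro sum.cong refl) (simp add: algebra_simps flip: power_add)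
    ultimately have "(\<Sum>n=3..<L. q ^ (2 * n + 3) * ((q\<^sup>2 - q ^ 5) * M n))
        + (\<Sum>n=3..<L. q ^ (3 * n + 6) + q ^ (3 * n + 7) + q ^ (3 * n + 8)) \<preceq> (\<Sum>n=3..<L. q ^ (2 * n + 3) * B n)"
      by simp
    note 1 = coeff_leD[OF this, of i]
    have "0 + q ^ 7 * q ^ 7 \<preceq> q ^ 5 * B 1 + q ^ 7 * B 2"
      by (intro coeff_le_add coeff_le_mult_q nonneg_mult_q B1 B2)
    then have "q ^ 14 \<preceq> q ^ 5 * B 1 + q ^ 7 * B 2"
      by (simp flip: power_add)
    note 2 = coeff_leD[OF this, of i]
    have "0 \<preceq> (\<Sum>n=3..<L. q ^ (2 * n + 7)) + q ^ 11"
      by (intro nonneg_add nonneg_sum) auto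
    note 3 = coeff_leD[OF this, of i]
    have 4: "fps_nth (q ^ (2 * L + 5) * M L) i = 0"
      using assms by (simp add: fps_X_power_mult_nth)
    have "0 \<le> fps_nth (\<Sum>n<L. q ^ (2 * n + 3) * B n) i"
      using 1 2 3 4 coeff_leD[OF tele, of i] coeff_leD[OF sum_even_powers_le[OF True], of i]
      unfolding S fps_add_nth fps_sub_nth fps_zero_nth by linarith
    then show ?thesis by (simp add: B_def)
  qed
qed

subsection \<open>q-factorials and the telescoped difference\<close>

definition qfact :: "nat \<Rightarrow> real fps" where
  "qfact p = (\<Prod>i=1..p. 1 - q ^ i)"

definition inv_qfact :: "nat \<Rightarrow> real fps" where
  "inv_qfact p = inverse (qfact p)"

lemma qfact_0 [simp]: "qfact 0 = 1"
  by (simp add: qfact_def)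

lemma qfact_Suc: "qfact (Suc p) = qfact p * (1 - q ^ Suc p)"
  by (simp add: qfact_def)

lemma qfact_nth_0 [simp]: "fps_nth (qfact p) 0 = 1"
  by (induction p) (simp_all add: qfact_Suc)

lemma qfact_inv_qfact [simp]: "qfact p * inv_qfact p = 1" "inv_qfact p * qfact p = 1"
  by (simp_all add: inv_qfact_def inverse_mult_eq_1 inverse_mult_eq_1')

lemma inv_qfact_0 [simp]: "inv_qfact 0 = 1"
  by (simp add: inv_qfact_def)

lemma inv_qfact_rec: "inv_qfact p = (1 - q ^ Suc p) * inv_qfact (Suc p)"
proof -
  have "inv_qfact p = inv_qfact p * (qfact (Suc p) * inv_qfact (Suc p))"
    by simp
  also have "\<dots> = (inv_qfact p * qfact p) * (1 - q ^ Suc p) * inv_qfact (Suc p)"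
    unfolding qfact_Suc by (simp only: mult_ac)
  finally show ?thesis by simp
qed

lemma qfact_mult_inv_qfact_upto:
  assumes "a \<le> b"
  shows "eq_upto a (qfact b * inv_qfact a) 1"
  using assms
proof (induction b rule: nat_induct_at_least)
  case (Suc b)
  have "eq_upto a (1 - q ^ Suc b) (1 - 0)"
    using Suc.hyps by (intro eq_upto_diff eq_upto_power) auto
  from eq_upto_mult[OF this Suc.IH] show ?case
    by (simp add: qfact_Suc mult_ac)
qed simp

section \<open>Gaussian binomial coefficients and the finite Jacobi triple product\<close>

definition qbinom :: "nat \<Rightarrow> nat \<Rightarrow> real fps" where
  "qbinom N j = (if j \<le> N then qfact N * inv_qfact j * inv_qfact (N - j) else 0)"

lemma qbinom_0 [simp]: "qbinom N 0 = 1"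
  by (simp add: qbinom_def)

lemma qbinom_eq_0: "N < j \<Longrightarrow> qbinom N j = 0"
  by (simp add: qbinom_def)

lemma qbinom_self [simp]: "qbinom N N = 1"
  by (simp add: qbinom_def)

text \<open>Over the common factor \<open>h\<close>, the two q-Pascal rules become 1 - uv = (1 - u)
  + u(1 - v) and its mirror image.\<close>

lemma qbinom_expand:
  fixes j k :: nat
  defines "N \<equiv> Suc (j + k)" and "h \<equiv> qfact (Suc (j + k)) * inv_qfact (Suc j) * inv_qfact (Suc k)"
  shows "qbinom (Suc N) (Suc j) = (1 - q ^ Suc j * q ^ Suc k) * h"
    "qbinom N j = (1 - q ^ Suc j) * h" "qbinom N (Suc j) = (1 - q ^ Suc k) * h"
proof -
  have "qfact (Suc N) = qfact N * (1 - q ^ Suc j * q ^ Suc k)"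
    unfolding qfact_Suc[of N] by (simp add: N_def power_add mult_ac)
  then show "qbinom (Suc N) (Suc j) = (1 - q ^ Suc j * q ^ Suc k) * h"
    by (simp add: qbinom_def N_def h_def mult_ac)
  show "qbinom N j = (1 - q ^ Suc j) * h" "qbinom N (Suc j) = (1 - q ^ Suc k) * h"
    by (simp_all add: qbinom_def N_def h_def inv_qfact_rec[of j] inv_qfact_rec[of k] Suc_diff_le mult_ac)
qed

lemma qbinom_Suc_Suc: "qbinom (Suc N) (Suc j) = qbinom N j + q ^ Suc j * qbinom N (Suc j)"
proof -
  consider "j < N" | "j = N" | "N < j" by linarith
  then show ?thesis
  proof cases
    case 1
    then obtain k where N: "N = Suc (j + k)"
      using less_imp_Suc_add by blast
    show ?thesis
      unfolding N qbinom_expand by (simp only: ring_distribs mult_ac) simp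
  qed (simp_all add: qbinom_eq_0)
qed

lemma qbinom_Suc_Suc':
  assumes "j \<le> N"
  shows "qbinom (Suc N) (Suc j) = qbinom N (Suc j) + q ^ (N - j) * qbinom N j"
proof (cases "j = N")
  case False
  then obtain k where N: "N = Suc (j + k)"
    using less_imp_Suc_add assms by (metis le_neq_implies_less)
  have "N - j = Suc k" using N by simp
  then show ?thesis
    unfolding N qbinom_expand by (simp add: algebra_simps)
qed (simp add: qbinom_eq_0)

definition tri :: "nat \<Rightarrow> nat" where
  "tri c = (\<Sum>i\<le>c. i)"

lemma tri_0 [simp]: "tri 0 = 0"
  by (simp add: tri_def)

lemma tri_Suc [simp]: "tri (Suc c) = tri c + Suc c"
  by (simp add: tri_def)

lemma tri_ge: "c \<le> tri c"
  by (induction c) auto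

lemma pair_gf_empty_neg: "c < 0 \<Longrightarrow> pair_gf {} B c = 0"
  by (auto simp: pair_gf_def)

lemma atLeastAtMost_Suc: "a \<le> Suc b \<Longrightarrow> {a..Suc b} = insert (Suc b) {a..b}"
  by auto

lemma pair_gf_empty_interval: "pair_gf {} {1..b} (int c) = q ^ tri c * qbinom b c"
proof (induction b arbitrary: c)
  case 0
  then show ?case by (cases c) (simp_all add: pair_gf_empty qbinom_eq_0)
next
  case (Suc b)
  have rec: "pair_gf {} {1..Suc b} (int c) = pair_gf {} {1..b} (int c) + q ^ Suc b * pair_gf {} {1..b} (int c - 1)"
    by (subst atLeastAtMost_Suc, simp, rule pair_gf_insert_right) auto
  show ?case
  proof (cases c)
    case 0
    then show ?thesis
      using Suc.IH[of 0] unfolding rec by (simp add: pair_gf_empty_neg)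
  next
    case (Suc k)
    then have "int c - 1 = int k" by simp
    then have *: "pair_gf {} {1..Suc b} (int c) = q ^ tri (Suc k) * qbinom b (Suc k) + q ^ Suc b * (q ^ tri k * qbinom b k)"
      unfolding rec using Suc.IH[of "Suc k"] Suc.IH[of k] Suc by simp
    show ?thesis
    proof (cases "k \<le> b")
      case True
      have "q ^ Suc b * q ^ tri k = q ^ tri (Suc k) * q ^ (b - k)"
        unfolding power_add[symmetric] using True by simp
      then show ?thesis
        unfolding * using True Suc
        by (simp only: qbinom_Suc_Suc' distrib_left mult.assoc[symmetric])
    next
      case False
      then show ?thesis
        unfolding * using Suc by (simp add: qbinom_eq_0)
    qed
  qed
qed

text \<open>The finite Jacobi triple product. Starting \<open>X\<close> at 0 makes it a single
  q-binomial coefficient, as the first q-Pascal rule matches the insertion of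
  \<open>a\<close>.\<close>

lemma pair_gf_interval: "pair_gf {0..<a} {1..b} (int c) = q ^ tri c * qbinom (a + b) (a + c)"
proof (induction a arbitrary: c)
  case 0
  then show ?case using pair_gf_empty_interval by simp
next
  case (Suc a)
  have "pair_gf {0..<Suc a} {1..b} (int c) = pair_gf {0..<a} {1..b} (int c) + q ^ a * pair_gf {0..<a} {1..b} (int (Suc c))"
    unfolding atLeast0_lessThan_Suc by (subst pair_gf_insert_left) (auto simp: add.commute)
  then show ?case
    unfolding Suc.IH by (simp add: qbinom_Suc_Suc power_add algebra_simps)
qed

text \<open>A truncation of the coefficient of z^c in (q)_inf divided by the product of all (1 - z
  q^i)(1 - q^(i+1) / z) with i >= 0.\<close>

definition crank_sum :: "nat \<Rightarrow> nat \<Rightarrow> real fps" where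
  "crank_sum L c = qfact L * (\<Sum>l\<le>L. q ^ l * inv_qfact l * inv_qfact (l + c))"

lemma crank_sum_telescope:
  "(\<Sum>l\<le>L. q ^ l * inv_qfact l * inv_qfact (l + c) + q ^ Suc c * (q ^ l * inv_qfact l * inv_qfact (l + Suc c)))
    = inv_qfact L * inv_qfact (L + Suc c)"
proof (induction L)
  case 0
  then show ?case by (simp add: inv_qfact_rec[of c] algebra_simps)
next
  case (Suc L)
  have "inv_qfact L = (1 - q ^ Suc L) * inv_qfact (Suc L)"
    "inv_qfact (L + Suc c) = (1 - q ^ Suc L * q ^ Suc c) * inv_qfact (Suc L + Suc c)"
    using inv_qfact_rec[of L] inv_qfact_rec[of "L + Suc c"] by (simp_all add: power_add mult_ac)
  moreover have "inv_qfact (Suc L + c) = (1 - q ^ Suc L * q ^ Suc c) * inv_qfact (Suc L + Suc c)"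
    using inv_qfact_rec[of "Suc L + c"] by (simp add: power_add mult_ac)
  moreover have "(1 - u) * h * ((1 - u * v) * k) + (u * h * ((1 - u * v) * k) + v * (u * h * k)) = h * k"
    for u v h k :: "real fps"
    by (simp add: algebra_simps)
  ultimately show ?case
    unfolding sum.atMost_Suc Suc.IH by simp
qed

lemma crank_sum_rec:
  "crank_sum L c + q ^ Suc c * crank_sum L (Suc c) = inv_qfact (L + Suc c)"
proof -
  have "crank_sum L c + q ^ Suc c * crank_sum L (Suc c) = qfact L * (inv_qfact L * inv_qfact (L + Suc c))"
    unfolding crank_sum_def crank_sum_telescope[symmetric] sum.distrib sum_distrib_left
    by (simp add: algebra_simps sum_distrib_left)
  then show ?thesis by (simp add: mult.assoc[symmetric])
qed

text \<open>
  Both sides satisfy the same first-order recurrence in \<open>c\<close> and vanish modulo \<open>q^(L+1)\<close> for large \<open>c\<close>,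
  so the induction runs downwards in \<open>c\<close>.
\<close>

lemma crank_sum_eq_pair_gf:
  "eq_upto L (q ^ tri c * crank_sum L c) (pair_gf {1..L} {1..L + m} (int c))"
proof (induction "L + m + 1 - c" arbitrary: c)
  case 0
  then have "L < tri c" "L + m < c"
    using tri_ge[of c] by auto
  then show ?case
    using eq_upto_power_mult[of L "tri c" "crank_sum L c"] by (simp add: pair_gf_zero)
next
  case (Suc j)
  then have c: "c \<le> L + m" by simp
  have IH: "eq_upto L (q ^ tri (Suc c) * crank_sum L (Suc c)) (pair_gf {1..L} {1..L + m} (int (Suc c)))"
    using Suc.hyps(2) by (intro Suc.hyps(1)) simp
  \<comment> \<open>Adjoining 0 to \<open>X\<close> makes \<open>pair_gf_interval\<close> applicable
    and yields a recurrence in \<open>c\<close>.\<close>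
  have "pair_gf {0..<Suc L} {1..L + m} (int c) = pair_gf {1..L} {1..L + m} (int c) + pair_gf {1..L} {1..L + m} (int (Suc c))"
  proof -
    have "{0..<Suc L} = insert 0 {1..L}" by auto
    then show ?thesis
      by (simp only:) (subst pair_gf_insert_left, auto simp: add.commute)
  qed
  then have V: "pair_gf {1..L} {1..L + m} (int c) = q ^ tri c * qbinom (Suc L + (L + m)) (Suc L + c) - pair_gf {1..L} {1..L + m} (int (Suc c))"
    unfolding pair_gf_interval by simp
  have "q ^ tri c * crank_sum L c = q ^ tri c * (crank_sum L c + q ^ Suc c * crank_sum L (Suc c)) - q ^ tri (Suc c) * crank_sum L (Suc c)"
    by (simp add: algebra_simps power_add)
  then have C: "q ^ tri c * crank_sum L c = q ^ tri c * inv_qfact (L + Suc c) - q ^ tri (Suc c) * crank_sum L (Suc c)"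
    by (simp only: crank_sum_rec)
  \<comment> \<open>Without the power of q the agreement is only ensured up to degree L + m - c; the
    factor \<open>q ^ tri c\<close> with \<open>tri c \<ge> c\<close> makes up for the loss.\<close>
  have "eq_upto L (q ^ tri c * inv_qfact (L + Suc c)) (q ^ tri c * qbinom (Suc L + (L + m)) (Suc L + c))"
  proof -
    have "eq_upto (L + m - c + tri c) (q ^ tri c * (qfact (Suc L + (L + m)) * inv_qfact (L + m - c))) (q ^ tri c * 1)"
      using c by (intro eq_upto_shift qfact_mult_inv_qfact_upto) auto
    then have "eq_upto L (q ^ tri c * 1) (q ^ tri c * (qfact (Suc L + (L + m)) * inv_qfact (L + m - c)))"
      by (rule eq_upto_sym[OF eq_upto_mono]) (use c tri_ge[of c] in linarith)
    from eq_upto_mult[OF this eq_upto_refl[of L "inv_qfact (L + Suc c)"]]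
    show ?thesis
      using c by (simp add: qbinom_def mult_ac)
  qed
  from eq_upto_diff[OF this IH] show ?case
    unfolding C V .
qed

section \<open>Telescoping of the difference series\<close>

lemma pair_gf_1_Suc:
  "pair_gf {1..Suc a} {1..b} c = pair_gf {1..a} {1..b} c + q ^ Suc a * pair_gf {1..a} {1..b} (c + 1)"
  by (subst atLeastAtMost_Suc[of 1 a], simp, rule pair_gf_insert_left) auto

lemma pair_gf_Suc_right:
  "finite A \<Longrightarrow> pair_gf A {1..Suc b} c = pair_gf A {1..b} c + q ^ Suc b * pair_gf A {1..b} (c - 1)"
  by (subst atLeastAtMost_Suc[of 1 b], simp, rule pair_gf_insert_right) auto

lemma pair_gf_telescope:
  "pair_gf {1..L} {1..L + m} (int m + 1) = (\<Sum>n<L. q ^ Suc n * pair_gf {1..n} {1..Suc n + m} (int m + 2)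
     + q ^ (Suc n + m) * pair_gf {1..n} {1..n + m} (int m))"
proof (induction L)
  case 0
  then show ?case by (simp add: pair_gf_zero)
next
  case (Suc L)
  have "pair_gf {1..Suc L} {1..Suc L + m} (int m + 1) =
      pair_gf {1..L} {1..Suc (L + m)} (int m + 1) + q ^ Suc L * pair_gf {1..L} {1..Suc L + m} (int m + 2)"
    unfolding pair_gf_1_Suc by (simp add: add.assoc)
  also have "pair_gf {1..L} {1..Suc (L + m)} (int m + 1) =
      pair_gf {1..L} {1..L + m} (int m + 1) + q ^ (Suc L + m) * pair_gf {1..L} {1..L + m} (int m)"
    by (subst pair_gf_Suc_right) simp_all
  finally show ?case
    unfolding sum.lessThan_Suc Suc.IH by (simp only: add_ac)
qed

text \<open>The generating function of \<open>N_S m\<close> minus \<open>N_S (m + 1)\<close>,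
  truncated, with \<open>qfact L\<close> in the role of (q)_inf.\<close>

definition spt_diff_series :: "nat \<Rightarrow> nat \<Rightarrow> real fps" where
  "spt_diff_series L m = (\<Sum>l\<le>L. q ^ (l + m + 1) * inv_qfact l * inv_qfact (l + m + 1) *
     (qfact L - (1 - q ^ l) * qfact (2 * l + m)))"

text \<open>With l = n + 1, the factor 1 - q^l turns \<open>inv_qfact l\<close> into
  \<open>inv_qfact n\<close>, and the quotient becomes
  \<open>qbinom (2 * l + m) (l + m + 1)\<close>.\<close>

lemma rank_term:
  "q ^ tri m * (q ^ (Suc n + m + 1) * inv_qfact (Suc n) * inv_qfact (Suc n + m + 1) * ((1 - q ^ Suc n) * qfact (2 * Suc n + m)))
   = q ^ Suc n * (pair_gf {1..n} {1..Suc n + m} (int m + 1) + pair_gf {1..n} {1..Suc n + m} (int m + 2))"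
proof -
  have "{0..<Suc n} = insert 0 {1..n}" by auto
  then have "pair_gf {1..n} {1..Suc n + m} (int m + 1) + pair_gf {1..n} {1..Suc n + m} (int m + 2)
      = pair_gf {0..<Suc n} {1..Suc n + m} (int (Suc m))"
    by (simp only:) (subst pair_gf_insert_left, auto simp: add.commute)
  also have "\<dots> = q ^ tri (Suc m) * (qfact (2 * Suc n + m) * inv_qfact (Suc n + m + 1) * inv_qfact n)"
    unfolding pair_gf_interval qbinom_def by (simp add: mult_2 add_ac)
  finally show ?thesis
    unfolding inv_qfact_rec[of n] by (simp add: power_add mult_ac)
qed

lemma spt_diff_series_eq:
  "eq_upto L (q ^ tri m * spt_diff_series L m)
    (\<Sum>n<L. q ^ (n + m + 1) * pair_gf {1..n} {1..n + m} (int m) - q ^ Suc n * pair_gf {1..n} {1..Suc n + m} (int m + 1))"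
proof -
  let ?r = "\<lambda>l. q ^ (l + m + 1) * inv_qfact l * inv_qfact (l + m + 1) * ((1 - q ^ l) * qfact (2 * l + m))"
  \<comment> \<open>The summand for \<open>l = 0\<close> vanishes through its factor
    \<open>1 - q ^ l\<close>.\<close>
  have "(\<Sum>l\<le>L. q ^ tri m * ?r l) = (\<Sum>n<L. q ^ tri m * ?r (Suc n))"
    by (subst sum.atMost_shift) simp
  then have B: "q ^ tri m * (\<Sum>l\<le>L. ?r l) = (\<Sum>n<L. q ^ Suc n * (pair_gf {1..n} {1..Suc n + m} (int m + 1)
      + pair_gf {1..n} {1..Suc n + m} (int m + 2)))"
    unfolding rank_term by (simp only: sum_distrib_left)
  have "spt_diff_series L m = q ^ Suc m * crank_sum L (Suc m) - (\<Sum>l\<le>L. ?r l)"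
    unfolding spt_diff_series_def crank_sum_def sum_subtractf[symmetric] sum_distrib_left
    by (intro sum.cong refl) (simp add: algebra_simps power_add)
  then have D: "q ^ tri m * spt_diff_series L m = q ^ tri (Suc m) * crank_sum L (Suc m) - q ^ tri m * (\<Sum>l\<le>L. ?r l)"
    by (simp only: tri_Suc power_add right_diff_distrib mult.assoc)
  have "eq_upto L (q ^ tri m * spt_diff_series L m) (pair_gf {1..L} {1..L + m} (int (Suc m)) -
    (\<Sum>n<L. q ^ Suc n * (pair_gf {1..n} {1..Suc n + m} (int m + 1) + pair_gf {1..n} {1..Suc n + m} (int m + 2))))"
    unfolding D B by (intro eq_upto_diff crank_sum_eq_pair_gf eq_upto_refl)
  also have "int (Suc m) = int m + 1" by simp
  also note pair_gf_telescope
  also have "(\<Sum>n<L. q ^ Suc n * pair_gf {1..n} {1..Suc n + m} (int m + 2) + q ^ (Suc n + m) * pair_gf {1..n} {1..n + m} (int m))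
    - (\<Sum>n<L. q ^ Suc n * (pair_gf {1..n} {1..Suc n + m} (int m + 1) + pair_gf {1..n} {1..Suc n + m} (int m + 2)))
    = (\<Sum>n<L. q ^ (n + m + 1) * pair_gf {1..n} {1..n + m} (int m) - q ^ Suc n * pair_gf {1..n} {1..Suc n + m} (int m + 1))"
    unfolding sum_subtractf[symmetric] by (intro sum.cong refl) (simp add: algebra_simps)
  finally show ?thesis .
qed

lemma pair_gf_2_Suc:
  assumes "n = 0 \<Longrightarrow> pair_gf {2..n} {1..b} (c + 1) = 0"
  shows "pair_gf {2..Suc n} {1..b} c = pair_gf {2..n} {1..b} c + q ^ Suc n * pair_gf {2..n} {1..b} (c + 1)"
proof (cases "n = 0")
  case False
  then have "{2..Suc n} = insert (Suc n) {2..n}" by auto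
  then show ?thesis
    by (simp only:) (rule pair_gf_insert_left, auto)
qed (use assms in simp)

text \<open>Shifting \<open>Y\<close> and splitting off single elements expresses both products
  through \<open>Z\<close>. The terms \<open>Z (int m)\<close> cancel, and removing
  \<open>n + 1\<close> from \<open>X\<close> in \<open>Z (int m + 1)\<close> produces
  \<open>\<tau> n\<close>.\<close>

lemma bracket_telescope:
  fixes m n :: nat
  defines "\<tau> \<equiv> \<lambda>i. q ^ (i + m + 2) * pair_gf {2..i} {1..i + m} (int m + 1)"
  shows "q ^ (Suc n + m + 1) * pair_gf {1..Suc n} {1..Suc n + m} (int m) - q ^ Suc n * pair_gf {1..n} {1..Suc n + m} (int m + 1)
    = q ^ (2 * n + m + 3) * (q ^ m * pair_gf {2..Suc n} {1..n + m} (int m - 1) - pair_gf {2..n} {1..n + m} (int m + 2))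
     + (\<tau> (Suc n) - \<tau> n)"
proof -
  define Z where "Z = pair_gf {2..Suc n} {1..n + m}"
  have Y: "{1..Suc n + m} = insert 1 (Suc ` {1..n + m})"
    unfolding image_Suc_atLeastAtMost by auto
  have X: "Suc ` {1..n} = {2..Suc n}"
    unfolding image_Suc_atLeastAtMost by simp
  have "pair_gf {1..n} {1..Suc n + m} (int (Suc m)) = pair_gf {1..n} (Suc ` {1..n + m}) (int (Suc m))
     + q * pair_gf {1..n} (Suc ` {1..n + m}) (int m)"
    unfolding Y by (subst pair_gf_insert_right) (auto simp: image_iff)
  also have "\<dots> = q ^ Suc m * (Z (int m + 1) + Z (int m))"
  proof -
    have *: "pair_gf {1..n} (Suc ` {1..n + m}) (int c) = q ^ c * Z (int c)" for c
      unfolding Z_def X[symmetric] by (rule pair_gf_shift) auto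
    show ?thesis
      unfolding * by (simp add: algebra_simps)
  qed
  finally have P2: "pair_gf {1..n} {1..Suc n + m} (int m + 1) = q ^ Suc m * (Z (int m + 1) + Z (int m))"
    by (simp add: add.commute)
  have "{1..Suc n} = insert 1 {2..Suc n}" by auto
  then have "pair_gf {1..Suc n} {1..Suc n + m} (int m) = pair_gf {2..Suc n} {1..Suc n + m} (int m)
      + q * pair_gf {2..Suc n} {1..Suc n + m} (int m + 1)"
    using pair_gf_insert_left[of "{2..Suc n}" "{1..Suc n + m}" 1 "int m"] by simp
  moreover have "pair_gf {2..Suc n} {1..Suc n + m} (int m) = Z (int m) + q ^ Suc (n + m) * Z (int m - 1)"
    using pair_gf_Suc_right[of "{2..Suc n}" "n + m" "int m"] by (simp add: Z_def)
  ultimately have P1: "pair_gf {1..Suc n} {1..Suc n + m} (int m) = Z (int m) + q ^ Suc (n + m) * Z (int m - 1)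
      + q * pair_gf {2..Suc n} {1..Suc n + m} (int m + 1)"
    by simp
  have "Z (int m + 1) = pair_gf {2..n} {1..n + m} (int m + 1) + q ^ Suc n * pair_gf {2..n} {1..n + m} (int m + 2)"
    unfolding Z_def by (subst pair_gf_2_Suc) (auto simp: pair_gf_zero add.assoc)
  then have "q ^ (n + m + 2) * Z (int m + 1) = \<tau> n + q ^ (2 * n + m + 3) * pair_gf {2..n} {1..n + m} (int m + 2)"
    by (simp add: \<tau>_def algebra_simps power_add mult_2 mult_2_right power2_eq_square numeral_3_eq_3)
  moreover have "q ^ (Suc n + m + 1) * pair_gf {1..Suc n} {1..Suc n + m} (int m)
      - q ^ Suc n * pair_gf {1..n} {1..Suc n + m} (int m + 1)
    = q ^ (2 * n + m + 3) * q ^ m * Z (int m - 1) + \<tau> (Suc n) - q ^ (n + m + 2) * Z (int m + 1)"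
    unfolding P1 P2 by (simp add: \<tau>_def algebra_simps power_add mult_2 mult_2_right power2_eq_square numeral_3_eq_3)
  ultimately show ?thesis
    by (simp add: Z_def algebra_simps)
qed

lemma spt_diff_series_nonneg:
  assumes "i \<le> L"
  shows "0 \<le> fps_nth (q ^ tri m * spt_diff_series L m) i"
proof -
  define \<tau> where "\<tau> i = q ^ (i + m + 2) * pair_gf {2..i} {1..i + m} (int m + 1)" for i
  define P1 where "P1 n = q ^ Suc (n + m) * pair_gf {1..n} {1..n + m} (int m)" for n
  define P2 where "P2 n = q ^ Suc n * pair_gf {1..n} {1..Suc n + m} (int m + 1)" for n
  define E where "E n = q ^ (2 * n + m + 3) * (q ^ m * pair_gf {2..Suc n} {1..n + m} (int m - 1)
     - pair_gf {2..n} {1..n + m} (int m + 2))" for n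
  \<comment> \<open>The brackets pair \<open>P1 (Suc n)\<close> with \<open>P2 n\<close>. This
    leaves \<open>P1 0\<close>, and \<open>P1 L\<close>, whose order exceeds
    \<open>L\<close>.\<close>
  have "(\<Sum>n<L. P1 n - P2 n) = P1 0 + (\<Sum>n<L. P1 (Suc n) - P2 n) - P1 L"
    by (induction L) (auto simp: algebra_simps)
  also have "(\<Sum>n<L. P1 (Suc n) - P2 n) = (\<Sum>n<L. E n + (\<tau> (Suc n) - \<tau> n))"
    using bracket_telescope by (simp add: P1_def P2_def E_def \<tau>_def)
  also have "\<dots> = (\<Sum>n<L. E n) + \<tau> L - \<tau> 0"
    by (simp add: sum.distrib sum_lessThan_telescope)
  also have "\<tau> 0 = 0"
    by (simp add: \<tau>_def pair_gf_zero)
  finally have S: "(\<Sum>n<L. P1 n - P2 n) = P1 0 + (\<Sum>n<L. E n) + \<tau> L - P1 L"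
    by simp
  have "fps_nth (q ^ tri m * spt_diff_series L m) i = fps_nth (\<Sum>n<L. P1 n - P2 n) i"
    using spt_diff_series_eq[of L m] assms by (simp add: eq_upto_def P1_def P2_def)
  also have "\<dots> = fps_nth (P1 0) i + fps_nth (\<Sum>n<L. E n) i + fps_nth (\<tau> L) i"
    unfolding S using assms by (simp add: P1_def fps_X_power_mult_nth del: power_Suc)
  also have "\<dots> \<ge> 0"
  proof (intro add_nonneg_nonneg)
    have "0 \<preceq> P1 0" "0 \<preceq> \<tau> L"
      unfolding P1_def \<tau>_def by (intro nonneg_mult_q pair_gf_nonneg)+
    then show "0 \<le> fps_nth (P1 0) i" "0 \<le> fps_nth (\<tau> L) i"
      by (auto dest: coeff_leD)
    show "0 \<le> fps_nth (\<Sum>n<L. E n) i"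
    proof (cases "m = 0")
      case True
      then show ?thesis
        using sum_bracket_zero_nonneg[of i L] assms by (simp add: E_def)
    next
      case False
      have "0 \<preceq> E n" for n
        unfolding E_def using False
        by (intro nonneg_mult_q coeff_le_diff_iff[THEN iffD2] pair_gf_bracket_le) simp
      then have "0 \<preceq> (\<Sum>n<L. E n)"
        by (intro nonneg_sum)
      from coeff_leD[OF this] show ?thesis by simp
    qed
  qed
  finally show ?thesis .
qed

subsection \<open>The generating function of the spt-crank\<close>

definition large_parts :: "nat \<Rightarrow> nat \<Rightarrow> nat multiset set" where
  "large_parts s p = {\<mu>. size \<mu> = p \<and> (\<forall>x\<in>#\<mu>. s \<le> x)}"

definition large_parts_gf :: "nat \<Rightarrow> nat \<Rightarrow> real fps" where
  "large_parts_gf s p = Abs_fps (\<lambda>w. real (card {\<mu> \<in> large_parts s p. sum_mset \<mu> = w}))"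

lemma finite_large_parts: "finite {\<mu> \<in> large_parts s p. sum_mset \<mu> \<le> w}"
proof (rule finite_subset)
  show "{\<mu> \<in> large_parts s p. sum_mset \<mu> \<le> w} \<subseteq> {\<mu>. set_mset \<mu> \<subseteq> {..w} \<and> size \<mu> = p}"
    by (auto simp: large_parts_def dest!: multi_member_split)
  show "finite {\<mu>. set_mset \<mu> \<subseteq> {..w} \<and> size \<mu> = p}"
    using finite_multisets_of_size[of "{..w}" p] by (simp add: multisets_of_size_def)
qed

lemma finite_large_parts_eq: "finite {\<mu> \<in> large_parts s p. sum_mset \<mu> = w}"
  by (rule finite_subset[OF _ finite_large_parts[of s p w]]) auto

lemma sum_mset_image_Suc: "sum_mset (image_mset Suc \<mu>) = sum_mset \<mu> + size \<mu>"
  by (induction \<mu>) auto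

lemma size_le_sum_mset: "\<forall>x\<in>#\<mu>. 0 < x \<Longrightarrow> size \<mu> \<le> sum_mset (\<mu> :: nat multiset)"
  by (induction \<mu>) (auto simp: Suc_le_eq)

text \<open>If \<open>s\<close> occurs, one copy is removed. Otherwise all parts exceed
  \<open>s\<close>, and lowering each by one takes \<open>Suc p\<close> from the sum.\<close>

lemma large_parts_gf_rec:
  "large_parts_gf s (Suc p) = q ^ s * large_parts_gf s p + q ^ Suc p * large_parts_gf s (Suc p)"
proof (rule fps_ext)
  fix w
  let ?A = "{\<mu> \<in> large_parts s (Suc p). sum_mset \<mu> = w \<and> s \<in># \<mu>}"
  let ?B = "{\<mu> \<in> large_parts s (Suc p). sum_mset \<mu> = w \<and> s \<notin># \<mu>}"
  have A: "card ?A = (if s \<le> w then card {\<mu> \<in> large_parts s p. sum_mset \<mu> = w - s} else 0)"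
  proof (cases "s \<le> w")
    case True
    have "bij_betw (add_mset s) {\<mu> \<in> large_parts s p. sum_mset \<mu> = w - s} ?A"
      by (rule bij_betw_byWitness[where f' = "\<lambda>\<mu>. \<mu> - {#s#}"])
        (use True in \<open>auto simp: large_parts_def size_Diff_singleton sum_mset_diff dest: in_diffD\<close>)
    from bij_betw_same_card[OF this] show ?thesis
      using True by simp
  next
    case False
    then have "?A = {}"
      by (auto dest!: multi_member_split)
    then show ?thesis using False by (simp only: card.empty if_False)
  qed
  have B: "card ?B = (if Suc p \<le> w then card {\<mu> \<in> large_parts s (Suc p). sum_mset \<mu> = w - Suc p} else 0)"
  proof (cases "Suc p \<le> w")
    case True
    have "bij_betw (image_mset Suc) {\<mu> \<in> large_parts s (Suc p). sum_mset \<mu> = w - Suc p} ?B"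
    proof (rule bij_betw_byWitness[where f' = "image_mset (\<lambda>x. x - 1)"])
      have *: "image_mset Suc (image_mset (\<lambda>x. x - 1) \<mu>) = \<mu>" if "\<mu> \<in> ?B" for \<mu>
      proof -
        have "Suc (x - 1) = x" if "x \<in># \<mu>" for x
          using that \<open>\<mu> \<in> ?B\<close> by (cases x) (auto simp: large_parts_def)
        then show ?thesis
          by (simp add: multiset.map_comp o_def cong: image_mset_cong)
      qed
      then show "\<forall>\<mu>\<in>?B. image_mset Suc (image_mset (\<lambda>x. x - 1) \<mu>) = \<mu>" by blast
      show "image_mset Suc ` {\<mu> \<in> large_parts s (Suc p). sum_mset \<mu> = w - Suc p} \<subseteq> ?B"
        using True by (auto simp: large_parts_def sum_mset_image_Suc le_Suc_eq) (meson Suc_n_not_le_n)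
      show "image_mset (\<lambda>x. x - 1) ` ?B \<subseteq> {\<mu> \<in> large_parts s (Suc p). sum_mset \<mu> = w - Suc p}"
      proof
        fix \<nu> assume "\<nu> \<in> image_mset (\<lambda>x. x - 1) ` ?B"
        then obtain \<mu> where \<mu>: "\<mu> \<in> ?B" "\<nu> = image_mset (\<lambda>x. x - 1) \<mu>" by blast
        have "sum_mset \<mu> = sum_mset \<nu> + size \<nu>"
          using sum_mset_image_Suc[of \<nu>] *[OF \<mu>(1)] \<mu>(2) by simp
        moreover have "s \<le> x - 1" if "x \<in># \<mu>" for x
        proof -
          have "s \<le> x" "s \<noteq> x" using that \<mu>(1) by (auto simp: large_parts_def)
          then show ?thesis by simp
        qed
        ultimately show "\<nu> \<in> {\<mu> \<in> large_parts s (Suc p). sum_mset \<mu> = w - Suc p}"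
          using \<mu> by (auto simp: large_parts_def)
      qed
    qed (auto simp: multiset.map_comp o_def)
    from bij_betw_same_card[OF this] show ?thesis
      using True by simp
  next
    case False
    have "0 < x" if "\<mu> \<in> ?B" "x \<in># \<mu>" for \<mu> x
      using that by (cases x) (auto simp: large_parts_def)
    then have "size \<mu> \<le> sum_mset \<mu>" if "\<mu> \<in> ?B" for \<mu>
      using that by (intro size_le_sum_mset) blast
    then have "?B = {}"
      using False by (force simp: large_parts_def)
    then show ?thesis using False by (simp only: card.empty if_False)
  qed
  have "{\<mu> \<in> large_parts s (Suc p). sum_mset \<mu> = w} = ?A \<union> ?B" by auto
  moreover have "card (?A \<union> ?B) = card ?A + card ?B"
    by (intro card_Un_disjoint finite_subset[OF _ finite_large_parts_eq[of s "Suc p" w]]) auto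
  ultimately have "card {\<mu> \<in> large_parts s (Suc p). sum_mset \<mu> = w} = card ?A + card ?B" by simp
  then show "fps_nth (large_parts_gf s (Suc p)) w =
      fps_nth (q ^ s * large_parts_gf s p + q ^ Suc p * large_parts_gf s (Suc p)) w"
    unfolding A B by (simp add: large_parts_gf_def fps_X_power_mult_nth del: power_Suc)
qed

lemma large_parts_gf_eq: "large_parts_gf s p = q ^ (s * p) * inv_qfact p"
proof (induction p)
  case 0
  have "{\<mu> \<in> large_parts s 0. sum_mset \<mu> = w} = (if w = 0 then {{#}} else {})" for w
    by (auto simp: large_parts_def)
  then show ?case
    by (auto simp: large_parts_gf_def fps_eq_iff)
next
  case (Suc p)
  have "(1 - q ^ Suc p) * large_parts_gf s (Suc p) = q ^ s * large_parts_gf s p"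
    using large_parts_gf_rec[of s p] by (simp add: algebra_simps)
  also have "\<dots> = (1 - q ^ Suc p) * (q ^ (s * Suc p) * inv_qfact (Suc p))"
    unfolding Suc.IH inv_qfact_rec[of p] by (simp only: mult_Suc_right power_add mult_ac)
  finally have "(1 - q ^ Suc p) * large_parts_gf s (Suc p) = (1 - q ^ Suc p) * (q ^ (s * Suc p) * inv_qfact (Suc p))" .
  moreover have "fps_nth (1 - q ^ Suc p) 0 \<noteq> 0"
    by simp
  then have "1 - q ^ Suc p \<noteq> 0"
    by (metis fps_zero_nth)
  ultimately show ?case
    by (simp only: mult_cancel_left) simp
qed

lemma sum_large_parts_upto:
  "eq_upto L (\<Sum>\<mu>\<in>{\<mu> \<in> large_parts s p. sum_mset \<mu> \<le> L}. q ^ sum_mset \<mu>) (q ^ (s * p) * inv_qfact p)"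
proof -
  have "fps_nth (\<Sum>\<mu>\<in>{\<mu> \<in> large_parts s p. sum_mset \<mu> \<le> L}. q ^ sum_mset \<mu>) i = fps_nth (large_parts_gf s p) i"
    if "i \<le> L" for i
  proof -
    have "(\<Sum>\<mu>\<in>{\<mu> \<in> large_parts s p. sum_mset \<mu> \<le> L}. if i = sum_mset \<mu> then 1 else 0 :: real)
      = (\<Sum>\<mu>\<in>{\<mu> \<in> {\<mu> \<in> large_parts s p. sum_mset \<mu> \<le> L}. i = sum_mset \<mu>}. 1)"
      by (rule sum.inter_filter[symmetric]) (rule finite_large_parts)
    also have "{\<mu> \<in> {\<mu> \<in> large_parts s p. sum_mset \<mu> \<le> L}. i = sum_mset \<mu>} = {\<mu> \<in> large_parts s p. sum_mset \<mu> = i}"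
      using that by auto
    finally show ?thesis
      by (simp add: fps_sum_nth large_parts_gf_def)
  qed
  then show ?thesis
    by (simp add: eq_upto_def large_parts_gf_eq)
qed

section \<open>Summation over the smallest part of the first partition\<close>

definition tail_qfact :: "nat \<Rightarrow> nat \<Rightarrow> real fps" where
  "tail_qfact L s = (\<Prod>i\<in>{s<..L}. 1 - q ^ i)"

lemma prod_eq_signed_sum:
  "finite A \<Longrightarrow> (\<Prod>i\<in>A. 1 - q ^ i) = (\<Sum>T\<in>Pow A. (- 1) ^ card T * q ^ \<Sum>T)"
proof (induction A rule: finite_induct)
  case (insert a A)
  have "(- 1) ^ card (insert a T) * q ^ \<Sum>(insert a T) = - (q ^ a * ((- 1) ^ card T * q ^ \<Sum>T))" if "T \<in> Pow A" for T
  proof -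
    have "finite T" "a \<notin> T" using that insert finite_subset by auto
    then show ?thesis by (simp add: power_add)
  qed
  then show ?case
    using insert by (simp add: sum_Pow_insert left_diff_distrib sum_distrib_left sum_negf sum_subtractf)
qed simp

lemma tail_qfact_diff:
  assumes "s < L"
  shows "tail_qfact L (Suc s) - tail_qfact L s = q ^ Suc s * tail_qfact L (Suc s)"
proof -
  have "{s<..L} = insert (Suc s) {Suc s<..L}" using assms by auto
  then have "tail_qfact L s = (1 - q ^ Suc s) * tail_qfact L (Suc s)"
    by (simp add: tail_qfact_def)
  then show ?thesis by (simp add: algebra_simps)
qed

lemma tail_qfact_0: "tail_qfact L 0 = qfact L"
  unfolding tail_qfact_def qfact_def by (intro prod.cong) auto

lemma tail_qfact_self: "tail_qfact L L = 1"
  by (simp add: tail_qfact_def)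

lemma sum_tail_qfact_rec:
  "qfact L + (\<Sum>s<L. q ^ (Suc s * Suc N) * tail_qfact L (Suc s))
    = (\<Sum>s<L. q ^ (Suc s * N) * tail_qfact L (Suc s)) - (\<Sum>s<L. q ^ (Suc s * N) * tail_qfact L s) + qfact L"
proof -
  have "(\<Sum>s<L. q ^ (Suc s * Suc N) * tail_qfact L (Suc s))
      = (\<Sum>s<L. q ^ (Suc s * N) * (tail_qfact L (Suc s) - tail_qfact L s))"
    by (intro sum.cong refl) (simp add: tail_qfact_diff power_add mult_ac)
  then show ?thesis
    by (simp add: right_diff_distrib sum_subtractf)
qed

text \<open>Truncates Euler's identity that q^(s(N+1)) (q^(s+1))_inf, summed over s >= 0, is (q)_N.
  The summand s = 0 is (q)_inf; \<open>G\<close> includes it and thereby obeys the recurrence of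
  \<open>qfact\<close>.\<close>

lemma sum_tail_qfact:
  "eq_upto L (\<Sum>s<L. q ^ (Suc s * Suc N) * tail_qfact L (Suc s)) (qfact N - qfact L)"
proof -
  define G where "G N = qfact L + (\<Sum>s<L. q ^ (Suc s * Suc N) * tail_qfact L (Suc s))" for N
  have "eq_upto L (G N) (qfact N)"
  proof (induction N)
    case 0
    have "G 0 = (\<Sum>s<L. tail_qfact L (Suc s) - tail_qfact L s) + qfact L"
      unfolding G_def sum_tail_qfact_rec by (simp add: sum_subtractf)
    then show ?case
      by (simp add: sum_lessThan_telescope tail_qfact_0 tail_qfact_self)
  next
    case (Suc N)
    have 1: "(\<Sum>s<L. q ^ (Suc s * Suc N) * tail_qfact L s) = q ^ Suc N * (\<Sum>s<L. q ^ (s * Suc N) * tail_qfact L s)"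
      by (simp add: sum_distrib_left power_add mult_ac)
    have "(\<Sum>s<L. q ^ (s * Suc N) * tail_qfact L s) + q ^ (L * Suc N) * tail_qfact L L
        = (\<Sum>s<Suc L. q ^ (s * Suc N) * tail_qfact L s)"
      by simp
    also have "\<dots> = G N"
      unfolding G_def by (subst sum.lessThan_Suc_shift) (simp add: tail_qfact_0)
    finally have *: "(\<Sum>s<L. q ^ (Suc s * Suc N) * tail_qfact L s) = q ^ Suc N * (G N - q ^ (L * Suc N))"
      unfolding 1 by (simp add: tail_qfact_self eq_diff_eq del: power_Suc)
    \<comment> \<open>The last power is the truncation error: \<open>G N\<close> has a summand
      \<open>s = L\<close> that the shifted sum lacks.\<close>
    have "G (Suc N) = (1 - q ^ Suc N) * G N + q ^ (Suc N + L * Suc N)"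
      unfolding G_def[of "Suc N"] sum_tail_qfact_rec[of L "Suc N"] * by (simp add: G_def algebra_simps power_add)
    moreover have "L < Suc N + L * Suc N"
      by simp
    then have "eq_upto L ((1 - q ^ Suc N) * G N + q ^ (Suc N + L * Suc N)) ((1 - q ^ Suc N) * qfact N + 0)"
      by (intro eq_upto_add eq_upto_mult eq_upto_refl Suc.IH eq_upto_power)
    ultimately show ?case
      by (simp add: qfact_Suc mult.commute)
  qed
  from eq_upto_diff[OF this eq_upto_refl[of L "qfact L"]] show ?thesis
    by (simp add: G_def)
qed

section \<open>From the signed count of triples to power series\<close>

lemma spt_series_term_diff:
  "(qfact (2 * l + k) - Q) * inv_qfact l * inv_qfact (l + k)
     - (qfact (2 * l + Suc k) - Q) * inv_qfact l * inv_qfact (l + Suc k)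
   = q ^ (l + k + 1) * inv_qfact l * inv_qfact (l + k + 1) * (Q - (1 - q ^ l) * qfact (2 * l + k))"
proof -
  have "qfact (2 * l + Suc k) = qfact (2 * l + k) * (1 - q ^ l * q ^ (l + k + 1))"
    using qfact_Suc[of "2 * l + k"] by (simp add: power_add mult_2 mult_2_right mult_ac)
  moreover have "inv_qfact (l + k) = (1 - q ^ (l + k + 1)) * inv_qfact (l + k + 1)"
    using inv_qfact_rec[of "l + k"] by simp
  moreover have "(F - Q) * h * ((1 - v) * h') - (F * (1 - u * v) - Q) * h * h' = v * h * h' * (Q - (1 - u) * F)"
    for F h h' u v :: "real fps"
    by (simp add: algebra_simps)
  ultimately show ?thesis
    by simp
qed

text \<open>\<open>s\<close> is the smallest part of the first component and \<open>T\<close> its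
  other parts. The lengths \<open>l + k\<close> and \<open>l\<close> build in the crank
  \<open>k\<close>; the bounds by \<open>L\<close> make the set finite.\<close>

definition spt_triples :: "nat \<Rightarrow> nat \<Rightarrow> (nat \<times> nat \<times> nat set \<times> nat multiset \<times> nat multiset) set" where
  "spt_triples L k = (SIGMA s:{1..L}. SIGMA l:{..L}. Pow {s<..L} \<times>
     {\<mu> \<in> large_parts s (l + k). sum_mset \<mu> \<le> L} \<times> {\<mu> \<in> large_parts s l. sum_mset \<mu> \<le> L})"

lemma N_S_eq_sum_triples:
  assumes "n \<le> L"
  shows "N_S (int k) n = (\<Sum>(s, l, T, \<mu>, \<nu>)\<in>{(s, l, T, \<mu>, \<nu>) \<in> spt_triples L k. s + \<Sum>T + sum_mset \<mu> + sum_mset \<nu> = n}. (- 1) ^ card T)"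
  unfolding N_S_def
proof (rule sum.reindex_bij_witness[where
      i = "\<lambda>(s, l, T, \<mu>, \<nu>). (insert s T, \<mu>, \<nu>)" and
      j = "\<lambda>(p1, p2, p3). (Min p1, size p3, p1 - {Min p1}, p2, p3)"])
  fix t assume "t \<in> {t \<in> spt_S. spt_weight t = n \<and> spt_crank t = int k}"
  moreover obtain p1 p2 p3 where t: "t = (p1, p2, p3)" by (cases t)
  ultimately have p1: "finite p1" "0 \<notin> p1" "p1 \<noteq> {}"
    and p23: "\<forall>x\<in>#p2. 0 < x" "\<forall>x\<in>#p3. 0 < x" "\<forall>x\<in>#p2. Min p1 \<le> x" "\<forall>x\<in>#p3. Min p1 \<le> x"
    and n: "\<Sum>p1 + sum_mset p2 + sum_mset p3 = n" and k: "size p2 = size p3 + k"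
    by (auto simp: spt_S_def is_distinct_partition_def is_partition_def spt_weight_def spt_crank_def)
  have Min: "Min p1 \<in> p1" using p1 by simp
  have le: "Min p1 \<le> x" "x \<le> L" if "x \<in> p1" for x
    using that p1 member_le_sum[of x p1 "\<lambda>x. x"] n assms by auto
  have sum: "\<Sum>p1 = Min p1 + \<Sum>(p1 - {Min p1})" and card: "card p1 - 1 = card (p1 - {Min p1})"
    using sum.remove[OF p1(1) Min] card_Diff_singleton[OF Min] by simp_all
  have "Min p1 > 0" using Min p1 by (metis gr0I)
  have "p1 - {Min p1} \<subseteq> {Min p1<..L}"
  proof
    fix x assume "x \<in> p1 - {Min p1}"
    with le[of x] show "x \<in> {Min p1<..L}" by simp
  qed
  moreover have "size p3 \<le> L"
    using size_le_sum_mset[OF p23(2)] n assms by simp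
  ultimately show "(case t of (p1, p2, p3) \<Rightarrow> (Min p1, size p3, p1 - {Min p1}, p2, p3))
      \<in> {(s, l, T, \<mu>, \<nu>) \<in> spt_triples L k. s + \<Sum>T + sum_mset \<mu> + sum_mset \<nu> = n}"
    using Min le \<open>Min p1 > 0\<close> p23 k n assms sum by (auto simp: t spt_triples_def large_parts_def)
  show "(case case t of (p1, p2, p3) \<Rightarrow> (Min p1, size p3, p1 - {Min p1}, p2, p3) of
      (s, l, T, \<mu>, \<nu>) \<Rightarrow> (insert s T, \<mu>, \<nu>)) = t"
    using Min by (auto simp: t)
  show "(case case t of (p1, p2, p3) \<Rightarrow> (Min p1, size p3, p1 - {Min p1}, p2, p3) of
      (s, l, T, \<mu>, \<nu>) \<Rightarrow> (- 1) ^ card T) = spt_sign t"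
    using card by (simp add: t spt_sign_def)
next
  fix u assume u: "u \<in> {(s, l, T, \<mu>, \<nu>) \<in> spt_triples L k. s + \<Sum>T + sum_mset \<mu> + sum_mset \<nu> = n}"
  moreover obtain s l T \<mu> \<nu> where u': "u = (s, l, T, \<mu>, \<nu>)" by (cases u)
  ultimately have s: "1 \<le> s" and T: "T \<subseteq> {s<..L}"
    and \<mu>: "size \<mu> = l + k" "\<forall>x\<in>#\<mu>. s \<le> x" and \<nu>: "size \<nu> = l" "\<forall>x\<in>#\<nu>. s \<le> x"
    and n: "s + \<Sum>T + sum_mset \<mu> + sum_mset \<nu> = n"
    by (auto simp: spt_triples_def large_parts_def)
  have "finite T" "s \<notin> T" using T finite_subset by auto
  moreover have "Min (insert s T) = s"
    using T \<open>finite T\<close> by (intro Min_eqI) auto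
  ultimately show "(case case u of (s, l, T, \<mu>, \<nu>) \<Rightarrow> (insert s T, \<mu>, \<nu>) of
      (p1, p2, p3) \<Rightarrow> (Min p1, size p3, p1 - {Min p1}, p2, p3)) = u"
    "(case u of (s, l, T, \<mu>, \<nu>) \<Rightarrow> (insert s T, \<mu>, \<nu>)) \<in> {t \<in> spt_S. spt_weight t = n \<and> spt_crank t = int k}"
    using s T \<mu> \<nu> n by (auto simp: u' spt_S_def is_distinct_partition_def is_partition_def spt_weight_def spt_crank_def
        intro: less_le_trans)
qed

text \<open>For fixed \<open>s\<close> and \<open>l\<close> the sum factorises. The powers of q
  combine to q^(s(2l+k+1)), so \<open>sum_tail_qfact\<close> carries out the sum over
  \<open>s\<close>.\<close>

lemma N_S_coeff:
  assumes "n \<le> L"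
  shows "real_of_int (N_S (int k) n)
    = fps_nth (\<Sum>l\<le>L. (qfact (2 * l + k) - qfact L) * inv_qfact l * inv_qfact (l + k)) n"
proof -
  define P where "P s p = {\<mu> \<in> large_parts s p. sum_mset \<mu> \<le> L}" for s p
  have fin: "finite (P s p)" for s p
    by (simp add: P_def finite_large_parts)
  have finite: "finite (spt_triples L k)"
    unfolding spt_triples_def by (auto simp: finite_large_parts)
  let ?w = "\<lambda>(s, l, T, \<mu>, \<nu>). s + \<Sum>T + sum_mset \<mu> + sum_mset \<nu>"
  have "real_of_int (N_S (int k) n) = (\<Sum>(s, l, T, \<mu>, \<nu>)\<in>{u \<in> spt_triples L k. ?w u = n}. (- 1) ^ card T)"
    unfolding N_S_eq_sum_triples[OF assms] of_int_sum by (intro sum.cong) auto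
  also have "\<dots> = (\<Sum>(s, l, T, \<mu>, \<nu>)\<in>spt_triples L k.
       if s + \<Sum>T + sum_mset \<mu> + sum_mset \<nu> = n then (- 1) ^ card T else 0)"
    by (subst sum.inter_filter[OF finite]) (auto intro!: sum.cong)
  also have "\<dots> = fps_nth (\<Sum>(s, l, T, \<mu>, \<nu>)\<in>spt_triples L k.
       (- 1) ^ card T * q ^ (s + \<Sum>T + sum_mset \<mu> + sum_mset \<nu>)) n"
  proof -
    have "fps_nth ((- 1) ^ j * f) i = (- 1) ^ j * fps_nth f i" for j i and f :: "real fps"
      by (cases "even j") auto
    then show ?thesis
      unfolding fps_sum_nth by (intro sum.cong) auto
  qed
  also have "(\<Sum>(s, l, T, \<mu>, \<nu>)\<in>spt_triples L k. (- 1) ^ card T * q ^ (s + \<Sum>T + sum_mset \<mu> + sum_mset \<nu>))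
    = (\<Sum>s=1..L. \<Sum>l\<le>L. q ^ s * tail_qfact L s * (\<Sum>\<mu>\<in>P s (l + k). q ^ sum_mset \<mu>) * (\<Sum>\<nu>\<in>P s l. q ^ sum_mset \<nu>))"
  proof -
    have "q ^ s * tail_qfact L s * (\<Sum>\<mu>\<in>P s (l + k). q ^ sum_mset \<mu>) * (\<Sum>\<nu>\<in>P s l. q ^ sum_mset \<nu>)
      = (\<Sum>T\<in>Pow {s<..L}. \<Sum>\<mu>\<in>P s (l + k). \<Sum>\<nu>\<in>P s l. (- 1) ^ card T * q ^ (s + \<Sum>T + sum_mset \<mu> + sum_mset \<nu>))" for s l
    proof -
      have "(\<Sum>\<mu>\<in>P s (l + k). \<Sum>\<nu>\<in>P s l. (- 1) ^ card T * q ^ (s + \<Sum>T + sum_mset \<mu> + sum_mset \<nu>))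
          = q ^ s * ((- 1) ^ card T * q ^ \<Sum>T) * (\<Sum>\<mu>\<in>P s (l + k). q ^ sum_mset \<mu>) * (\<Sum>\<nu>\<in>P s l. q ^ sum_mset \<nu>)" for T
        unfolding mult.assoc sum_product unfolding sum_distrib_left by (simp add: power_add mult_ac)
      then show ?thesis
        unfolding tail_qfact_def prod_eq_signed_sum[OF finite_greaterThanAtMost]
        by (simp only: sum_distrib_right[symmetric] sum_distrib_left[symmetric])
    qed
    then show ?thesis
      unfolding spt_triples_def P_def[symmetric]
      by (simp add: sum.Sigma fin)
  qed
  also have "fps_nth \<dots> n = fps_nth (\<Sum>l\<le>L. (qfact (2 * l + k) - qfact L) * inv_qfact l * inv_qfact (l + k)) n"
  proof -
    have "eq_upto L (\<Sum>s=1..L. \<Sum>l\<le>L. q ^ s * tail_qfact L s * (\<Sum>\<mu>\<in>P s (l + k). q ^ sum_mset \<mu>) * (\<Sum>\<nu>\<in>P s l. q ^ sum_mset \<nu>))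
      (\<Sum>s=1..L. \<Sum>l\<le>L. q ^ s * tail_qfact L s * (q ^ (s * (l + k)) * inv_qfact (l + k)) * (q ^ (s * l) * inv_qfact l))"
      unfolding P_def by (intro eq_upto_sum eq_upto_mult eq_upto_refl sum_large_parts_upto)
    also have "\<dots> = (\<Sum>l\<le>L. (\<Sum>s=1..L. q ^ (s * Suc (2 * l + k)) * tail_qfact L s) * inv_qfact l * inv_qfact (l + k))"
      by (subst sum.swap) (simp add: sum_distrib_right sum_distrib_left power_add mult_ac mult_2 mult_2_right distrib_left)
    also have "\<dots> = (\<Sum>l\<le>L. (\<Sum>s<L. q ^ (Suc s * Suc (2 * l + k)) * tail_qfact L (Suc s)) * inv_qfact l * inv_qfact (l + k))"
      by (simp only: sum.atLeast1_atMost_eq One_nat_def)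
    also have "eq_upto L \<dots> (\<Sum>l\<le>L. (qfact (2 * l + k) - qfact L) * inv_qfact l * inv_qfact (l + k))"
      by (intro eq_upto_sum eq_upto_mult eq_upto_refl sum_tail_qfact)
    finally show ?thesis
      using assms by (simp add: eq_upto_def)
  qed
  finally show ?thesis .
qed

theorem mainTheorem1:
  fixes m :: int and n :: nat
  assumes "0 \<le> m"
  shows "N_S m n \<ge> N_S (m + 1) n"
proof -
  define k where "k = nat m"
  have k: "m + 1 = int (Suc k)" "m = int k"
    using assms by (simp_all add: k_def)
  \<comment> \<open>Nonnegativity is known after multiplication by \<open>q ^ tri k\<close>, which
    moves the coefficient in question to \<open>n + tri k\<close>.\<close>
  define L where "L = n + tri k"
  have "n \<le> L" by (simp add: L_def)
  then have "real_of_int (N_S m n) - real_of_int (N_S (m + 1) n) = fps_nth (spt_diff_series L k) n"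
    unfolding k(1) unfolding k(2)
    by (simp only: N_S_coeff fps_sub_nth[symmetric] sum_subtractf[symmetric] spt_series_term_diff spt_diff_series_def)
  also have "\<dots> = fps_nth (q ^ tri k * spt_diff_series L k) (n + tri k)"
    by (simp add: fps_X_power_mult_nth)
  also have "\<dots> \<ge> 0"
    by (rule spt_diff_series_nonneg) (simp add: L_def)
  finally show ?thesis by simp
qed

end
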